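(* Let $k\ge1$ and $n\geq 2k+8$ be integers. There is no function $\varphi:(0,1]\to\mathbb{R}^{+}$ having the following property: for every $u\in W^{1,k+1}(B_1,|x|^{1-k})$ that is a semistable radially increasing solution of a problem of the type $S_k(D^2u)=g(u)$ in $B_1\setminus\{0\}$ with $g'\leq 0$, there exist $C>0$ and $\epsilon\in(0,1]$ such that $|u'''(r)|\leq C\varphi(r)$ for every $r\in(0,\epsilon]$.
   Context: $B_1$ is the open unit ball of $\mathbb{R}^n$; a function is radial if $u(x)=u(r)$, $r=|x|$, $r\in(0,1]$, and primes denote derivatives in $r$. $W^{1,k+1}(B_1,|x|^{1-k})$ is the space of weakly differentiable $u\in L^{k+1}(B_1)$ with $\int_{B_1}|x|^{1-k}|\nabla u|^{k+1}dx<\infty$. $S_k(D^2u)$ is the $k$-th elementary symmetric function of the eigenvalues of the Hessian $D^2u$, and $S_k^{ij}(D^2u)=\frac{\partial}{\partial u_{ij}}S_k(D^2u)$ with $u_{ij}=u_{x_ix_j}$. That a radial $u$ is a solution of a problem of the type $S_k(D^2u)=g(u)$ in $B_1\setminus\{0\}$ with $g'\le0$ means that $u$ is $C^2$ in $r\in(0,1]$ and there is a positive $C^1$ function $g:\mathbb{R}\to\mathbb{R}$ with $g'\le0$ such that the equation holds pointwise in $B_1\setminus\{0\}$ (for radially increasing $u$, it is then $C^3$ in $r\in(0,1]$); it is semistable if $\int_{B_1}\{\sum\psi_i\psi_jS_k^{ij}(D^2u)+g'(u)\psi^2\}dx\ge0$ for all $\psi\in C_c^1(B_1\setminus\{0\})$,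 where $\psi_i=\psi_{x_i}$. Radially increasing means increasing in $r$. *)

theory Defs
  imports "HOL-Analysis.Analysis"
    "HOL-Computational_Algebra.Fundamental_Theorem_Algebra"
begin

section \<open>Elementary symmetric functions of the eigenvalues\<close>

definition char_polynomial :: "real^'n^'n \<Rightarrow> complex poly" where
  "char_polynomial A =
     det (\<chi> i j. if i = j then [:- of_real (A$i$j), 1:] else [:- of_real (A$i$j):])"

text \<open>
  The eigenvalues are listed with algebraic multiplicity. They are taken in the complex numbers so
  that the functions below are defined for every real square matrix: the derivative with
  respect to a single matrix entry leaves the symmetric matrices.
\<close>

definition eigenvalues :: "real^'n^'n \<Rightarrow> 'n \<Rightarrow> complex" where
  "eigenvalues A = (SOME lam. char_polynomial A = (\<Prod>i\<in>UNIV. [:- lam i, 1:]))"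

lemma char_polynomial_eigenvalues:
  fixes A :: "real^'n^'n"
  shows "char_polynomial A = (\<Prod>i\<in>UNIV. [:- eigenvalues A i, 1:])"
proof -
  define M :: "complex poly^'n^'n" where
    "M = (\<chi> i j. if i = j then [:- of_real (A$i$j), 1:] else [:- of_real (A$i$j):])"
  define T where "T = (\<lambda>p. of_int (sign p) * (\<Prod>i\<in>UNIV. M$i$p i))"
  define P where "P = {p. p permutes (UNIV :: 'n set)}"
  have finP: "finite P" and idP: "id \<in> P"
    by (auto simp: P_def finite_permutations permutes_id)
  have deg_sign: "degree (of_int (sign p) * q) \<le> degree q" for p :: "'n \<Rightarrow> 'n" and q :: "complex poly"
    by (simp add: sign_def)
  have T_id: "T id = (\<Prod>i\<in>UNIV. [:- of_real (A$i$i), 1:])"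
    by (simp add: T_def M_def sign_id)
  have deg_id: "degree (T id) = CARD('n)"
    unfolding T_id by (subst degree_prod_sum_eq) auto
  have lead_id: "lead_coeff (T id) = 1"
    unfolding T_id by (subst lead_coeff_prod) simp
  have less: "degree (T p) < CARD('n)" if p: "p \<in> P - {id}" for p
  proof -
    from p obtain a where a: "p a \<noteq> a" by (auto simp: fun_eq_iff)
    have "degree (T p) \<le> degree (\<Prod>i\<in>UNIV. M$i$p i)"
      unfolding T_def by (rule deg_sign)
    also have "\<dots> \<le> (\<Sum>i\<in>UNIV. degree (M$i$p i))"
      using degree_prod_sum_le[of UNIV "\<lambda>i. M$i$p i"] by simp
    also have "\<dots> < (\<Sum>i\<in>(UNIV::'n set). 1)"
    proof (rule sum_strict_mono_ex1)
      show "\<exists>i\<in>UNIV. degree (M$i$p i) < 1"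
        using a by (intro bexI[of _ a]) (auto simp: M_def)
    qed (auto simp: M_def)
    finally show ?thesis by simp
  qed
  have split: "char_polynomial A = T id + (\<Sum>p\<in>P - {id}. T p)"
    unfolding char_polynomial_def det_def T_def P_def[symmetric] M_def[symmetric]
    using finP idP by (rule sum.remove)
  have rest: "degree (\<Sum>p\<in>P - {id}. T p) < CARD('n)"
    by (rule degree_sum_less) (use less in auto)
  have deg: "degree (char_polynomial A) = CARD('n)"
    unfolding split using rest deg_id by (subst degree_add_eq_left) auto
  have "coeff (\<Sum>p\<in>P - {id}. T p) (CARD('n)) = 0"
    using rest by (rule coeff_eq_0)
  then have lead: "lead_coeff (char_polynomial A) = 1"
    using lead_id unfolding deg by (simp add: split deg_id)
  then have "char_polynomial A \<noteq> 0" by auto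
  from alg_closed_imp_factorization[OF this] obtain B
    where B: "size B = CARD('n)" "char_polynomial A = (\<Prod>x\<in>#B. [:-x, 1:])"
    unfolding deg[symmetric] lead by auto
  obtain xs where xs: "mset xs = B" using ex_mset by blast
  then have len: "length xs = CARD('n)" using B(1) by auto
  obtain h where h: "bij_betw h (UNIV :: 'n set) {0..<CARD('n)}"
    using ex_bij_betw_finite_nat[OF finite[of "UNIV :: 'n set"]] by blast
  have "char_polynomial A = (\<Prod>i\<in>{0..<CARD('n)}. [:- (xs!i), 1:])"
    unfolding B(2) xs[symmetric] using len
    by (metis (no_types, lifting) atLeast0LessThan length_map lessThan_iff mset_map nth_map prod.cong
        prod.list_conv_set_nth prod_mset_prod_list atLeastLessThan_iff)
  also have "\<dots> = (\<Prod>i\<in>UNIV. [:- (xs!(h i)), 1:])"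
    using prod.reindex_bij_betw[OF h, of "\<lambda>i. [:- (xs!i), 1:]"] by simp
  finally have "\<exists>lam. char_polynomial A = (\<Prod>i\<in>(UNIV::'n set). [:- lam i, 1:])"
    by (rule exI[where x = "\<lambda>i. xs ! h i"])
  then show ?thesis
    unfolding eigenvalues_def by (rule someI_ex)
qed

text \<open>The sum is real, since the characteristic polynomial has real coefficients.\<close>

definition Sk :: "nat \<Rightarrow> real^'n^'n \<Rightarrow> real" where
  "Sk k A = Re (\<Sum>I | card I = k. \<Prod>i\<in>I. eigenvalues A i)"

definition matrix_unit :: "'n \<Rightarrow> 'n \<Rightarrow> real^'n^'n" where
  "matrix_unit i j = (\<chi> a b. if a = i \<and> b = j then 1 else 0)"

text \<open>The partial derivative of \<^term>\<open>Sk k\<close> treats all entries as independent variables.\<close>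

definition Sk_deriv :: "nat \<Rightarrow> 'n \<Rightarrow> 'n \<Rightarrow> real^'n^'n \<Rightarrow> real" where
  "Sk_deriv k i j A = deriv (\<lambda>t. Sk k (A + t *\<^sub>R matrix_unit i j)) 0"


section \<open>Derivatives, test functions and the weighted Sobolev space\<close>

definition partial_derivative :: "'n \<Rightarrow> (real^'n \<Rightarrow> real) \<Rightarrow> real^'n \<Rightarrow> real" where
  "partial_derivative i f x = deriv (\<lambda>t. f (x + t *\<^sub>R axis i 1)) 0"

definition hessian :: "(real^'n \<Rightarrow> real) \<Rightarrow> real^'n \<Rightarrow> real^'n^'n" where
  "hessian f x = (\<chi> i j. partial_derivative j (partial_derivative i f) x)"

definition test_function :: "(real^'n) set \<Rightarrow> (real^'n \<Rightarrow> real) \<Rightarrow> bool" where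
  "test_function \<Omega> \<psi> \<longleftrightarrow>
     \<psi> differentiable_on UNIV \<and> (\<forall>i. continuous_on UNIV (partial_derivative i \<psi>)) \<and>
     compact (closure {x. \<psi> x \<noteq> 0}) \<and> closure {x. \<psi> x \<noteq> 0} \<subseteq> \<Omega>"

definition locally_integrable ::
    "(real^'n) set \<Rightarrow> (real^'n \<Rightarrow> 'b::euclidean_space) \<Rightarrow> bool" where
  "locally_integrable \<Omega> f \<longleftrightarrow> (\<forall>K. compact K \<and> K \<subseteq> \<Omega> \<longrightarrow> f absolutely_integrable_on K)"

text \<open>Test functions of class \<open>C\<^sub>c\<^sup>1\<close> give the same weak gradients as smooth ones, by mollification.\<close>

definition weak_gradient ::
    "(real^'n) set \<Rightarrow> (real^'n \<Rightarrow> real) \<Rightarrow> (real^'n \<Rightarrow> real^'n) \<Rightarrow> bool" where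
  "weak_gradient \<Omega> u G \<longleftrightarrow>
     locally_integrable \<Omega> u \<and> locally_integrable \<Omega> G \<and>
     (\<forall>\<psi> i. test_function \<Omega> \<psi> \<longrightarrow>
        (LINT x:\<Omega>|lebesgue. u x * partial_derivative i \<psi> x) = - (LINT x:\<Omega>|lebesgue. G x $ i * \<psi> x))"

definition weighted_sobolev :: "nat \<Rightarrow> (real^'n \<Rightarrow> real) \<Rightarrow> bool" where
  "weighted_sobolev k u \<longleftrightarrow>
     set_borel_measurable lebesgue (ball 0 1) u \<and>
     set_integrable lebesgue (ball 0 1) (\<lambda>x. \<bar>u x\<bar> ^ (k + 1)) \<and>
     (\<exists>G. weak_gradient (ball 0 1) u G \<and>
        set_integrable lebesgue (ball 0 1)
          (\<lambda>x. norm x powr (1 - real k) * norm (G x) ^ (k + 1)))"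


section \<open>Radial semistable solutions\<close>

text \<open>The value of \<open>u\<close> at the origin is left free.\<close>

definition radial_with_profile :: "(real^'n \<Rightarrow> real) \<Rightarrow> (real \<Rightarrow> real) \<Rightarrow> bool" where
  "radial_with_profile u U \<longleftrightarrow> (\<forall>x. 0 < norm x \<and> norm x \<le> 1 \<longrightarrow> u x = U (norm x))"

text \<open>The derivative in \<open>r \<in> (0,1]\<close>; it is one-sided at \<open>r = 1\<close> only.\<close>

definition rderiv :: "(real \<Rightarrow> real) \<Rightarrow> real \<Rightarrow> real" where
  "rderiv f r = vector_derivative f (at r within {0<..1})"

definition C2_profile :: "(real \<Rightarrow> real) \<Rightarrow> bool" where
  "C2_profile U \<longleftrightarrow>
     U differentiable_on {0<..1} \<and> rderiv U differentiable_on {0<..1} \<and>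
     continuous_on {0<..1} (rderiv (rderiv U))"

definition admissible_rhs :: "(real \<Rightarrow> real) \<Rightarrow> bool" where
  "admissible_rhs g \<longleftrightarrow>
     (\<forall>t. g t > 0) \<and> g differentiable_on UNIV \<and> continuous_on UNIV (deriv g) \<and>
     (\<forall>t. deriv g t \<le> 0)"

definition semistable :: "nat \<Rightarrow> (real \<Rightarrow> real) \<Rightarrow> (real^'n \<Rightarrow> real) \<Rightarrow> bool" where
  "semistable k g u \<longleftrightarrow>
     (\<forall>\<psi>. test_function (ball 0 1 - {0}) \<psi> \<longrightarrow>
        (LINT x:ball 0 1|lebesgue.
           (\<Sum>i\<in>UNIV. \<Sum>j\<in>UNIV. partial_derivative i \<psi> x * partial_derivative j \<psi> x * Sk_deriv k i j (hessian u x))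
           + deriv g (u x) * (\<psi> x)\<^sup>2) \<ge> 0)"

definition semistable_radial_solution ::
    "nat \<Rightarrow> (real^'n \<Rightarrow> real) \<Rightarrow> (real \<Rightarrow> real) \<Rightarrow> bool" where
  "semistable_radial_solution k u U \<longleftrightarrow>
     radial_with_profile u U \<and> C2_profile U \<and>
     (\<exists>g. admissible_rhs g \<and>
        (\<forall>x\<in>ball 0 1 - {0}. Sk k (hessian u x) = g (u x)) \<and>
        semistable k g u)"

end

theory Submission
  imports Defs
begin

text \<open>
  Write \<open>u'(r) = v(r) / r\<close>. The point of the proof is that the hypotheses on a solution only
  involve one-sided bounds on \<open>v''\<close>. Any function \<open>v \<ge> 1\<close> on \<open>(0,\<infinity>)\<close> that is increasing, concave
  and of linear growth yields an admissible \<open>u\<close> as soon as \<open>n \<ge> 2k + 8\<close>, and concavity allows \<open>v''\<close>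
  to be as negative as one likes. Since \<open>u''' = v''/r - 2v'/r\<^sup>2 + 2v/r\<^sup>3\<close>, a concave \<open>v\<close> whose
  slope drops steeply enough at the points \<open>1/(m+1)\<close> defeats any given \<open>\<phi>\<close>. Such a \<open>v\<close> is a
  series of smoothed corners of rapidly decreasing size and rapidly increasing steepness
  (\<open>exists_concave_function_with_large_second_derivative\<close>).

  The following quantities explain why \<open>u\<close> is admissible. Let \<open>\<alpha> = u'/r\<close> and \<open>\<gamma> = u''\<close> be the
  eigenvalues of the Hessian, \<open>b = r v'/v\<close>, \<open>q = r\<^sup>2 v''/v\<close>, and let \<open>c\<close> be the binomial
  coefficient of \<open>n - 1\<close> over \<open>k - 1\<close>. Concavity and positivity give \<open>0 \<le> b \<le> 1\<close> and \<open>q \<le> 0\<close>.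

  Equation: \<open>S\<^sub>k(D\<^sup>2u) = (c/k) \<alpha>\<^sup>k (n - 2k + k b)\<close> is positive, and its radial derivative has the
  sign of \<open>(b - 2)(n - 2k + k b) + b + q - b\<^sup>2\<close>, which is negative. As \<open>v \<ge> 1\<close>, the function \<open>u\<close>
  maps \<open>(0,\<infinity>)\<close> bijectively onto the whole line, so the equation defines \<open>g\<close> everywhere. It is
  essential here that \<open>u\<close> is unbounded at the origin: the steep drops sit at values of \<open>u\<close> that
  tend to \<open>-\<infinity>\<close>, where \<open>g'\<close> is free to blow up.

  Semistability: the angular part of the quadratic form is nonnegative, and the radial part
  is \<open>R \<psi>\<^sub>r\<^sup>2 + g'(u) \<psi>\<^sup>2\<close> with \<open>R = c \<alpha> ^ (k - 1)\<close>. Subtracting the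
  divergence of the field \<open>- (R (4 - b)/r\<^sup>2) \<psi>\<^sup>2 x\<close>, whose integral vanishes, cancels the
  uncontrolled term \<open>q\<close> and leaves
  \<open>R (\<psi>\<^sub>r + (4 - b) \<psi>/r)\<^sup>2 + (R/r\<^sup>2) (2 (n - 2k) - 16 + b (2k + 4)) \<psi>\<^sup>2\<close>
  (\<open>riccati_inequality\<close>). This is where the bound on the dimension enters.

  Integrability: \<open>u'\<close> is of order \<open>1/r\<close>, so the weighted Sobolev condition reduces to the
  integrability of the power \<open>-2k\<close> of \<open>|x|\<close> near the origin. The weak gradient is obtained from
  the regularised functions \<open>u(sqrt (|x|\<^sup>2 + \<epsilon>\<^sup>2))\<close> by dominated convergence.
\<close>

section \<open>Elementary symmetric functions of radial matrices\<close>

text \<open>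
  Subtracting multiples of row \<open>k\<close> clears the multiples of \<open>v\<close> from all other rows; what remains
  is the identity with one row replaced, a case of Cramer's rule.
\<close>

lemma det_row_replaced:
  fixes u v :: "'a::field^'n"
  assumes "k \<notin> T"
  shows "det (\<chi> i. if i = k then v else if i \<in> T then axis i 1 + u$i *s v else axis i 1) = v$k"
  using finite[of T] assms
proof (induction T rule: finite_induct)
  case empty
  have "(\<Sum>i\<in>UNIV. v$i *s row i (mat 1 :: 'a^'n^'n)) = v"
    by (simp add: vec_eq_iff row_def mat_def if_distrib cong: if_cong)
  moreover have "row i (mat 1 :: 'a^'n^'n) = axis i 1" for i
    by (auto simp: vec_eq_iff row_def mat_def axis_def)
  ultimately show ?case
    using cramer_lemma_transpose[of k v "mat 1"] by (simp only: empty_iff if_False det_I mult_1_right)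
next
  case (insert l T)
  define A where "A = (\<chi> i. if i = k then v else if i \<in> T then axis i 1 + u$i *s v else axis i 1)"
  have "l \<noteq> k" using insert by auto
  have "(\<chi> i. if i = k then v else if i \<in> insert l T then axis i 1 + u$i *s v else axis i 1) =
      (\<chi> i. if i = l then row l A + u$l *s row k A else row i A)"
    using insert by (auto simp: vec_eq_iff A_def row_def)
  then show ?case
    using det_row_operation[OF \<open>l \<noteq> k\<close>, of A "u$l"] insert by (simp add: A_def)
qed

lemma Re_complex_of_real_mult: "Re (of_real a * z) = a * Re z" by simp

text \<open>
  The rows are switched from \<open>e\<^sub>i\<close> to \<open>e\<^sub>i + u\<^sub>i v\<close> one at a time. By multilinearity each switch adds
  \<open>u\<^sub>i\<close> times the determinant with row \<open>i\<close> equal to \<open>v\<close>, which is \<open>v\<^sub>i\<close>.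
\<close>

lemma det_identity_plus_rank_one:
  fixes u v :: "'a::field^'n"
  shows "det (\<chi> i j. (if i = j then 1 else 0) + u$i * v$j) = 1 + (\<Sum>i\<in>UNIV. u$i * v$i)"
proof -
  have "det (\<chi> i. if i \<in> T then axis i 1 + u$i *s v else axis i 1) = 1 + (\<Sum>i\<in>T. u$i * v$i)" for T
    using finite[of T]
  proof (induction T rule: finite_induct)
    case empty
    have "(\<chi> i. axis i 1) = (mat 1 :: 'a^'n^'n)"
      by (auto simp: vec_eq_iff mat_def axis_def)
    then show ?case by simp
  next
    case (insert k T)
    define c where "c = (\<lambda>i. if i \<in> T then axis i 1 + u$i *s v else axis i 1)"
    have "(\<chi> i. if i \<in> insert k T then axis i 1 + u$i *s v else axis i 1) =
        (\<chi> i. if i = k then axis i 1 + u$k *s v else c i)"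
      by (auto simp: vec_eq_iff c_def)
    moreover have "(\<chi> i. if i = k then axis i 1 else c i) = (\<chi> i. c i)"
      using insert by (auto simp: vec_eq_iff c_def)
    moreover have "(\<chi> i. c i) = (\<chi> i. if i \<in> T then axis i 1 + u$i *s v else axis i 1)"
      by (simp add: c_def)
    moreover have "det (\<chi> i. if i = k then v else c i) = v$k"
      using det_row_replaced[OF \<open>k \<notin> T\<close>, of v u] by (simp only: c_def)
    ultimately have "det (\<chi> i. if i \<in> insert k T then axis i 1 + u$i *s v else axis i 1) =
        1 + (\<Sum>i\<in>T. u$i * v$i) + u$k * v$k"
      by (simp only: det_row_add det_row_mul insert.IH)
    then show ?case
      using insert by (simp add: add_ac)
  qed
  moreover have "(\<chi> i j. (if i = j then 1 else 0) + u$i * v$j) = (\<chi> i. if i \<in> UNIV then axis i 1 + u$i *s v else axis i 1)"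
    by (auto simp: vec_eq_iff axis_def)
  ultimately show ?thesis by presburger
qed

lemma coeff_prod_linear_factors:
  fixes lam :: "'n::finite \<Rightarrow> complex"
  assumes "k \<le> CARD('n)"
  shows "coeff (\<Prod>i\<in>UNIV. [:- lam i, 1:]) (CARD('n) - k) = (-1)^k * (\<Sum>I | card I = k. \<Prod>i\<in>I. lam i)"
proof -
  have "(\<Prod>i\<in>UNIV. [:- lam i, 1:]) = (\<Prod>i\<in>UNIV. [:- lam i:] + monom 1 1)"
    by (simp add: monom_altdef)
  also have "\<dots> = (\<Sum>I\<in>UNIV. (\<Prod>i\<in>I. [:- lam i:]) * (\<Prod>i\<in>UNIV-I. monom 1 1))"
    by (subst prod_add) auto
  also have "\<dots> = (\<Sum>I\<in>UNIV. monom (\<Prod>i\<in>I. - lam i) (CARD('n) - card I))"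
  proof (rule sum.cong)
    fix I :: "'n set"
    have "(\<Prod>i\<in>I. [:- lam i:]) = [:\<Prod>i\<in>I. - lam i:]"
      by (induction I rule: infinite_finite_induct) auto
    then show "(\<Prod>i\<in>I. [:- lam i:]) * (\<Prod>i\<in>UNIV-I. monom 1 1) = monom (\<Prod>i\<in>I. - lam i) (CARD('n) - card I)"
      by (simp add: monom_power card_Diff_subset smult_monom)
  qed auto
  finally have "coeff (\<Prod>i\<in>UNIV. [:- lam i, 1:]) (CARD('n) - k) =
     (\<Sum>I\<in>UNIV. if CARD('n) - card I = CARD('n) - k then \<Prod>i\<in>I. - lam i else 0)"
    by (simp add: coeff_sum)
  also have "\<dots> = (\<Sum>I\<in>UNIV. if card I = k then \<Prod>i\<in>I. - lam i else 0)"
  proof (rule sum.cong)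
    fix I :: "'n set"
    have "card I \<le> CARD('n)" by (simp add: card_mono)
    then have "CARD('n) - card I = CARD('n) - k \<longleftrightarrow> card I = k" using assms by auto
    then show "(if CARD('n) - card I = CARD('n) - k then \<Prod>i\<in>I. - lam i else 0) = (if card I = k then \<Prod>i\<in>I. - lam i else 0)"
      by simp
  qed auto
  also have "\<dots> = (\<Sum>I | card I = k. \<Prod>i\<in>I. - lam i)"
    by (simp add: sum.If_cases)
  also have "\<dots> = (\<Sum>I | card I = k. (-1)^k * (\<Prod>i\<in>I. lam i))"
    by (rule sum.cong) (auto simp: prod_uminus)
  finally show ?thesis by (simp add: sum_distrib_left)
qed

text \<open>
  Coefficients of the characteristic polynomial depend on the matrix entries polynomially, so this
  form, unlike the one by eigenvalues, can be differentiated with respect to single entries.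
\<close>

lemma Sk_eq_coeff:
  fixes A :: "real^'n^'n"
  assumes "k \<le> CARD('n)"
  shows "Sk k A = (-1)^k * Re (coeff (char_polynomial A) (CARD('n) - k))"
proof -
  have "coeff (char_polynomial A) (CARD('n) - k) = (-1)^k * (\<Sum>I | card I = k. \<Prod>i\<in>I. eigenvalues A i)"
    unfolding char_polynomial_eigenvalues by (rule coeff_prod_linear_factors[OF assms])
  then have "(-1)^k * coeff (char_polynomial A) (CARD('n) - k) = (\<Sum>I | card I = k. \<Prod>i\<in>I. eigenvalues A i)"
    by (simp add: mult.assoc[symmetric] power_mult_distrib[symmetric])
  then have "Sk k A = Re ((-1)^k * coeff (char_polynomial A) (CARD('n) - k))"
    by (simp add: Sk_def)
  also have "\<dots> = Re (of_real ((-1)^k) * coeff (char_polynomial A) (CARD('n) - k))"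
    by simp
  also have "\<dots> = (-1)^k * Re (coeff (char_polynomial A) (CARD('n) - k))"
    by (rule Re_complex_of_real_mult)
  finally show ?thesis .
qed

lemma poly_char_polynomial:
  "poly (char_polynomial A) s = det (\<chi> i j. (if i = j then s else 0) - of_real (A$i$j))"
  by (auto simp: char_polynomial_def det_def poly_sum poly_prod intro!: sum.cong prod.cong)

text \<open>
  The Hessian of a radial function has this form. Its eigenvalues are \<open>a\<close> on the orthogonal
  complement of \<open>x\<close> and \<open>a + b |x|\<^sup>2\<close> in the direction of \<open>x\<close>.
\<close>

definition radial_matrix :: "real \<Rightarrow> real \<Rightarrow> real^'n \<Rightarrow> real^'n^'n" where
  "radial_matrix a b x = (\<chi> i j. (if i = j then a else 0) + b * (x$i * x$j))"

text \<open>
  After the shift by \<open>a\<close>, the matrix is \<open>M - t e\<^sub>i e\<^sub>j\<^sup>T\<close> with \<open>M = y I - b x x\<^sup>T\<close>. Outside of its two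
  eigenvalues \<open>M\<close> is invertible with an explicit inverse, so it factors out and both remaining
  determinants are rank-one perturbations of multiples of the identity.
\<close>

lemma poly_char_polynomial_radial_matrix_perturbed:
  fixes x :: "real^'n" and y :: complex
  assumes n: "CARD('n) \<ge> 2" and y: "y \<noteq> 0" "y \<noteq> of_real (b * (norm x)\<^sup>2)"
  shows "poly (char_polynomial (radial_matrix a b x + t *\<^sub>R matrix_unit i j)) (y + of_real a) =
     y ^ (CARD('n) - 1) * (y - of_real (b * (norm x)\<^sup>2)) -
     of_real t * (y ^ (CARD('n) - 2) *
       ((if i = j then y - of_real (b * (norm x)\<^sup>2) else 0) + of_real (b * (x$i * x$j))))"
proof -
  define \<rho> where "\<rho> = complex_of_real ((norm x)\<^sup>2)"
  define B where "B = complex_of_real b"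
  define X where "X = (\<lambda>i. complex_of_real (x$i))"
  have \<rho>: "\<rho> = (\<Sum>i\<in>UNIV. X i * X i)"
    unfolding \<rho>_def X_def by (simp add: dot_square_norm[symmetric] inner_vec_def)
  have y': "y \<noteq> B * \<rho>" using y(2) by (simp add: B_def \<rho>_def)
  define M where "M = (\<chi> i j. (if i = j then y else 0) - B * (X i * X j))"
  \<comment> \<open>\<open>w\<close> is column \<open>i\<close> of the inverse of \<open>M\<close>.\<close>
  define w where "w = (\<lambda>c. ((if c = i then 1 else 0) + B * X i * X c / (y - B * \<rho>)) / y)"
  define Q where "Q = (\<chi> c d. (if c = d then 1 else 0) + (- of_real t * w c) * (if d = j then 1 else 0))"
  have M_w: "(\<Sum>c\<in>UNIV. M$d$c * w c) = (if d = i then 1 else 0)" for d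
  proof -
    have "(\<Sum>c\<in>UNIV. M$d$c * w c) = y * w d - B * X d * (\<Sum>c\<in>UNIV. X c * w c)"
      by (simp add: M_def left_diff_distrib sum_subtractf if_distrib[of "\<lambda>z. z * _"] sum_distrib_left mult.assoc cong: if_cong)
    also have "(\<Sum>c\<in>UNIV. X c * w c) = (X i + B * X i * \<rho> / (y - B * \<rho>)) / y"
    proof -
      have "(\<Sum>c\<in>UNIV. X c * w c) = (\<Sum>c\<in>UNIV. ((if c = i then X c else 0) + (B * X i / (y - B * \<rho>)) * (X c * X c)) / y)"
        by (rule sum.cong) (auto simp: w_def algebra_simps)
      then show ?thesis
        by (simp add: sum_divide_distrib[symmetric] sum.distrib sum_distrib_left[symmetric] \<rho>[symmetric])
    qed
    also have "\<dots> = X i / (y - B * \<rho>)"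
      using y' y(1) by (simp add: divide_simps) (simp add: algebra_simps)?
    finally show ?thesis
      using y' y(1) by (simp add: w_def divide_simps)
  qed
  have "(\<chi> d c. (if d = c then y + of_real a else 0) - of_real ((radial_matrix a b x + t *\<^sub>R matrix_unit i j)$d$c)) = M ** Q"
  proof -
    have "(M ** Q)$d$c = M$d$c - of_real t * (if d = i then 1 else 0) * (if c = j then 1 else 0)" for d c
      unfolding M_w[symmetric]
      by (cases "c = j") (simp_all add: Q_def matrix_matrix_mult_def distrib_left sum.distrib if_distrib[of "\<lambda>z. _ * z"]
          sum_distrib_left sum_negf sum_distrib_right mult_ac cong: if_cong)
    then show ?thesis
      by (auto simp: vec_eq_iff M_def radial_matrix_def matrix_unit_def B_def X_def)
  qed
  then have "poly (char_polynomial (radial_matrix a b x + t *\<^sub>R matrix_unit i j)) (y + of_real a) = det M * det Q"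
    by (simp add: poly_char_polynomial det_mul)
  also have "det Q = 1 - of_real t * w j"
  proof -
    have "Q = (\<chi> c d. (if c = d then 1 else 0) + (\<chi> c. - of_real t * w c)$c * (axis j 1)$d)"
      by (auto simp: Q_def vec_eq_iff axis_def)
    then show ?thesis
      by (simp only: det_identity_plus_rank_one) (simp add: axis_def if_distrib[of "\<lambda>z. _ * z"] cong: if_cong)
  qed
  also have "det M = y ^ (CARD('n) - 1) * (y - B * \<rho>)"
  proof -
    have "M = (\<chi> c. y *s (\<chi> d. (if c = d then 1 else 0) + (\<chi> c. - B * X c / y)$c * (\<chi> d. X d)$d))"
      using y(1) by (auto simp: M_def vec_eq_iff algebra_simps)
    then have "det M = y ^ CARD('n) * (1 + (\<Sum>i\<in>UNIV. - B * X i / y * X i))"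
      by (simp only: det_rows_mul det_identity_plus_rank_one) simp
    also have "(\<Sum>i\<in>UNIV. - B * X i / y * X i) = - B / y * \<rho>"
      unfolding \<rho> by (simp add: sum_distrib_left mult_ac)
    finally show ?thesis
      using y(1) n power_eq_if[of y "CARD('n)"] by (simp add: right_diff_distrib distrib_left)
  qed
  also have "y ^ (CARD('n) - 1) * (y - B * \<rho>) * (1 - of_real t * w j) =
     y ^ (CARD('n) - 1) * (y - B * \<rho>) - of_real t * (y ^ (CARD('n) - 2) * (y * (y - B * \<rho>) * w j))"
  proof -
    have "CARD('n) - 1 = Suc (CARD('n) - 2)" using n by simp
    then show ?thesis by (simp only: power_Suc) (simp add: algebra_simps)
  qed
  also have "y * (y - B * \<rho>) * w j = (if i = j then y - B * \<rho> else 0) + B * (X i * X j)"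
    using y' y(1) by (simp add: w_def field_simps)
  finally show ?thesis by (simp add: B_def \<rho>_def X_def)
qed

text \<open>
  Both sides are polynomials that agree outside of two points.
\<close>

lemma char_polynomial_radial_matrix_perturbed:
  fixes x :: "real^'n" and a b :: real
  assumes n: "CARD('n) \<ge> 2"
  defines "q \<equiv> [:- complex_of_real a, 1:]" and "l \<equiv> [:- complex_of_real (a + b * (norm x)\<^sup>2), 1:]"
  shows "char_polynomial (radial_matrix a b x + t *\<^sub>R matrix_unit i j) =
     q ^ (CARD('n) - 1) * l -
     smult (of_real t) (q ^ (CARD('n) - 2) * ((if i = j then l else 0) + [:of_real (b * (x$i * x$j)):]))"
    (is "?p = ?q")
proof -
  have eq: "poly ?p s = poly ?q s" if "s \<noteq> of_real a" "s \<noteq> of_real (a + b * (norm x)\<^sup>2)" for s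
  proof -
    have linear: "poly [:- c, 1:] s = s - c" for c :: complex
      by simp
    have l_eq: "poly l s = s - of_real a - of_real (b * (norm x)\<^sup>2)"
      by (simp add: l_def)
    have "poly ?q s = (s - of_real a) ^ (CARD('n) - 1) * poly l s - of_real t * ((s - of_real a) ^ (CARD('n) - 2) *
        ((if i = j then poly l s else 0) + of_real (b * (x$i * x$j))))"
    proof -
      have const: "poly [:c:] s = c" for c :: complex by simp
      show ?thesis
        by (cases "i = j") (simp_all only: q_def poly_diff poly_mult poly_power linear const poly_smult poly_add
          if_True if_False poly_0 simp_thms)
    qed
    then show ?thesis
      using poly_char_polynomial_radial_matrix_perturbed[OF n, of "s - of_real a" b x a t i j] that
      unfolding l_eq by (simp add: diff_eq_eq add.commute)
  qed
  have "infinite (UNIV - {complex_of_real a, of_real (a + b * (norm x)\<^sup>2)})"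
    by (rule Diff_infinite_finite) (auto simp: infinite_UNIV_char_0)
  moreover have "UNIV - {complex_of_real a, of_real (a + b * (norm x)\<^sup>2)} \<subseteq> {s. poly (?p - ?q) s = 0}"
    using eq by auto
  ultimately have "infinite {s. poly (?p - ?q) s = 0}"
    using finite_subset by blast
  then have "?p - ?q = 0"
    using poly_roots_finite by blast
  then show ?thesis by simp
qed

lemma coeff_power_times_linear:
  fixes a c :: "'a::comm_ring_1"
  assumes "1 \<le> k" "k \<le> m"
  shows "coeff ([:- a, 1:] ^ m * [:- c, 1:]) (Suc m - k) =
     (-1)^k * (of_nat (m choose k) * a ^ k + of_nat (m choose (k - 1)) * a ^ (k - 1) * c)"
proof -
  have "Suc m - k = Suc (m - k)" using assms by simp
  then have "coeff ([:- a, 1:] ^ m * [:- c, 1:]) (Suc m - k) =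
      coeff ([:- a, 1:] ^ m) (m - k) - c * coeff ([:- a, 1:] ^ m) (Suc (m - k))"
    by simp
  also have "coeff ([:- a, 1:] ^ m) (m - k) = of_nat (m choose k) * (- a) ^ k"
    using assms by (subst coeff_linear_poly_power) (auto simp: binomial_symmetric[of k m])
  also have "coeff ([:- a, 1:] ^ m) (Suc (m - k)) = of_nat (m choose (k - 1)) * (- a) ^ (k - 1)"
  proof -
    have *: "m - Suc (m - k) = k - 1" "m choose Suc (m - k) = m choose (k - 1)"
      using assms binomial_symmetric[of "k - 1" m] by (auto simp: Suc_diff_le)
    show ?thesis using assms by (subst coeff_linear_poly_power) (auto simp: *)
  qed
  also have "of_nat (m choose k) * (- a) ^ k - c * (of_nat (m choose (k - 1)) * (- a) ^ (k - 1)) =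
     (-1)^k * (of_nat (m choose k) * a ^ k + of_nat (m choose (k - 1)) * a ^ (k - 1) * c)"
  proof -
    have "(- a) ^ k = (-1)^k * a ^ k" "(- a) ^ (k - 1) = - ((-1)^k * a ^ (k - 1))"
      using assms by (cases k; simp add: power_minus[of a])+
    then show ?thesis by (simp add: algebra_simps)
  qed
  finally show ?thesis .
qed

lemma Sk_radial_matrix:
  fixes x :: "real^'n" and a b :: real
  assumes "1 \<le> k" "k < CARD('n)"
  shows "Sk k (radial_matrix a b x) = (CARD('n) - 1 choose k) * a ^ k +
    (CARD('n) - 1 choose (k - 1)) * a ^ (k - 1) * (a + b * (norm x)\<^sup>2)"
proof -
  define n where "n = CARD('n) - 1"
  have n: "CARD('n) = Suc n" "k \<le> n" using assms by (auto simp: n_def)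
  have "char_polynomial (radial_matrix a b x) =
      [:- complex_of_real a, 1:] ^ n * [:- complex_of_real (a + b * (norm x)\<^sup>2), 1:]"
    using char_polynomial_radial_matrix_perturbed[of a b x 0] assms by (simp add: n_def)
  then have "Sk k (radial_matrix a b x) = (-1)^k * Re ((-1)^k * (of_nat (n choose k) * of_real a ^ k +
      of_nat (n choose (k - 1)) * of_real a ^ (k - 1) * of_real (a + b * (norm x)\<^sup>2)))"
    using assms n by (simp only: Sk_eq_coeff coeff_power_times_linear less_imp_le)
  also have "\<dots> = (-1)^k * Re (of_real ((-1)^k * ((n choose k) * a ^ k + (n choose (k - 1)) * a ^ (k - 1) * (a + b * (norm x)\<^sup>2))))"
    by (simp only: of_real_mult of_real_add of_real_power of_real_of_nat_eq of_real_minus of_real_1)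
  also have "\<dots> = (n choose k) * a ^ k + (n choose (k - 1)) * a ^ (k - 1) * (a + b * (norm x)\<^sup>2)"
    by (simp only: Re_complex_of_real mult.assoc[symmetric] power_mult_distrib[symmetric]) simp
  finally show ?thesis by (simp add: n_def)
qed

text \<open>
  The characteristic polynomial is affine in a single matrix entry, so the derivative is read off
  from the coefficient of \<open>t\<close>. \<open>D\<close> is the elementary symmetric function of degree \<open>k - 2\<close> of
  \<open>n - 2\<close> copies of \<open>a\<close>; it is \<open>0\<close> for \<open>k = 1\<close>, where truncated subtraction would give \<open>1\<close>.
\<close>

lemma Sk_deriv_radial_matrix:
  fixes x :: "real^'n" and a b :: real
  assumes "1 \<le> k" "k < CARD('n)"
  defines "D \<equiv> (if k = 1 then 0 else (CARD('n) - 2 choose (k - 2)) * a ^ (k - 2))"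
  shows "Sk_deriv k i j (radial_matrix a b x) =
     (if i = j then (CARD('n) - 2 choose (k - 1)) * a ^ (k - 1) + D * (a + b * (norm x)\<^sup>2) else 0)
     - b * D * (x$i * x$j)"
proof -
  define m where "m = CARD('n) - 2"
  have m: "CARD('n) = Suc (Suc m)" "k \<le> Suc m" using assms by (auto simp: m_def)
  define q where "q = [:- complex_of_real a, 1:]"
  define c where "c = a + b * (norm x)\<^sup>2"
  define \<beta> where "\<beta> = b * (x$i * x$j)"
  define E where "E = (m choose (k - 1)) * a ^ (k - 1) + D * c"
  have 1: "coeff (q ^ m * [:- of_real c, 1:]) (CARD('n) - k) = of_real ((-1)^(k - 1) * E)"
  proof (cases "k = 1")
    case True
    have "coeff (q ^ m) (Suc m) = 0"
      by (intro coeff_eq_0) (simp add: q_def degree_linear_power)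
    then show ?thesis
      using True m by (simp add: E_def D_def q_def coeff_linear_power)
  next
    case False
    then have *: "1 \<le> k - 1" "k - 1 \<le> m" "CARD('n) - k = Suc m - (k - 1)" "k - 1 - 1 = k - 2"
      using assms m by auto
    have "coeff (q ^ m * [:- of_real c, 1:]) (CARD('n) - k) = (-1) ^ (k - 1) *
       (of_nat (m choose (k - 1)) * of_real a ^ (k - 1) + of_nat (m choose (k - 2)) * of_real a ^ (k - 2) * of_real c)"
      unfolding q_def *(3) by (subst coeff_power_times_linear) (use * in auto)
    then show ?thesis using False by (simp add: E_def D_def m_def)
  qed
  have 2: "coeff (q ^ m * [:of_real \<beta>:]) (CARD('n) - k) = of_real ((-1)^k * D * \<beta>)"
  proof (cases "k = 1")
    case True
    have "coeff (q ^ m) (Suc m) = 0"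
      by (intro coeff_eq_0) (simp add: q_def degree_linear_power)
    then show ?thesis
      using True m by (simp add: D_def)
  next
    case False
    then have *: "k - 2 \<le> m" "CARD('n) - k = m - (k - 2)" "m - (m - (k - 2)) = k - 2"
      using assms m by auto
    have "coeff (q ^ m) (m - (k - 2)) = of_nat (m choose (k - 2)) * (- of_real a) ^ (k - 2)"
      unfolding q_def using * by (subst coeff_linear_poly_power) (auto simp: binomial_symmetric[of "k - 2" m])
    also have "(- complex_of_real a) ^ (k - 2) = (-1)^k * of_real a ^ (k - 2)"
    proof -
      obtain l where "k = Suc (Suc l)" using False assms by (intro that[of "k - 2"]) auto
      then show ?thesis by (simp add: power_minus[of "complex_of_real a"])
    qed
    finally show ?thesis
      using False unfolding *(2) D_def by (simp add: m_def[symmetric])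
  qed
  have Sk_t: "Sk k (radial_matrix a b x + t *\<^sub>R matrix_unit i j) =
      Sk k (radial_matrix a b x) + t * ((if i = j then E else 0) - D * \<beta>)" for t
  proof -
    have cp: "char_polynomial (radial_matrix a b x + t *\<^sub>R matrix_unit i j) = char_polynomial (radial_matrix a b x) -
       smult (of_real t) (q ^ m * ((if i = j then [:- of_real c, 1:] else 0) + [:of_real \<beta>:]))" for t
      using char_polynomial_radial_matrix_perturbed[of a b x t i j] 
        char_polynomial_radial_matrix_perturbed[of a b x 0 i j] assms(1,2)
      by (simp add: q_def c_def \<beta>_def m_def)
    have "Re (coeff (q ^ m * ((if i = j then [:- of_real c, 1:] else 0) + [:of_real \<beta>:])) (CARD('n) - k)) =
      (-1)^(k - 1) * (if i = j then E else 0) + (-1)^k * D * \<beta>"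
      unfolding distrib_left coeff_add plus_complex.sel 2 Re_complex_of_real
      by (cases "i = j") (simp_all only: 1 Re_complex_of_real if_True if_False mult_zero_right coeff_0 zero_complex.sel simp_thms)
    then have "Re (coeff (char_polynomial (radial_matrix a b x + t *\<^sub>R matrix_unit i j)) (CARD('n) - k)) =
       Re (coeff (char_polynomial (radial_matrix a b x)) (CARD('n) - k)) -
        t * ((-1)^(k - 1) * (if i = j then E else 0) + (-1)^k * D * \<beta>)"
      unfolding cp by (simp only: coeff_diff coeff_smult minus_complex.sel Re_complex_of_real_mult)
    moreover have "(-1::real)^(k - 1) = - ((-1)^k)" using assms by (cases k) auto
    ultimately show ?thesis
      using assms(2) by (simp only: Sk_eq_coeff less_imp_le) (cases "even k"; simp add: algebra_simps)
  qed
  have "((\<lambda>t. Sk k (radial_matrix a b x + t *\<^sub>R matrix_unit i j)) has_real_derivative ((if i = j then E else 0) - D * \<beta>)) (at 0)"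
    unfolding Sk_t by (auto intro!: derivative_eq_intros)
  then show ?thesis
    unfolding Sk_deriv_def by (simp add: DERIV_imp_deriv E_def c_def \<beta>_def m_def)
qed

text \<open>
  The form splits into a multiple of the radial part of \<open>\<xi>\<close>, which is the right-hand side, and
  \<open>E\<close> times the squared length of the angular part. The hypotheses on the eigenvalues and on \<open>k\<close>
  make \<open>E\<close> nonnegative, because the binomial coefficients increase up to the middle.
\<close>

lemma Sk_deriv_radial_matrix_ge:
  fixes x \<xi> :: "real^'n" and a b :: real
  assumes k: "1 \<le> k" "2 * k \<le> CARD('n)" and a: "a > 0" and c: "a + b * (norm x)\<^sup>2 \<ge> - a" and x: "x \<noteq> 0"
  shows "(\<Sum>i\<in>UNIV. \<Sum>j\<in>UNIV. \<xi>$i * \<xi>$j * Sk_deriv k i j (radial_matrix a b x)) \<ge>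
     (CARD('n) - 1 choose (k - 1)) * a ^ (k - 1) * ((x \<bullet> \<xi>) / norm x)\<^sup>2"
proof -
  define m where "m = CARD('n) - 2"
  define D where "D = (if k = 1 then 0 else (m choose (k - 2)) * a ^ (k - 2))"
  define E where "E = (m choose (k - 1)) * a ^ (k - 1) + D * (a + b * (norm x)\<^sup>2)"
  have "k < CARD('n)" using k by auto
  have D: "D \<ge> 0" using a by (simp add: D_def)
  have Da: "D * a \<le> (m choose (k - 1)) * a ^ (k - 1)"
    and sum: "(m choose (k - 1)) * a ^ (k - 1) + D * a = (CARD('n) - 1 choose (k - 1)) * a ^ (k - 1)"
  proof -
    show "D * a \<le> (m choose (k - 1)) * a ^ (k - 1)"
    proof (cases "k = 1")
      case False
      have "m choose (k - 2) \<le> m choose (k - 1)"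
        using k False by (intro binomial_mono) (auto simp: m_def)
      moreover have "a ^ (k - 1) = a ^ (k - 2) * a"
        using k False power_eq_if[of a "k - 1"] by (simp add: numeral_2_eq_2)
      ultimately show ?thesis
        using a False by (simp add: D_def)
    qed (simp add: D_def)
    show "(m choose (k - 1)) * a ^ (k - 1) + D * a = (CARD('n) - 1 choose (k - 1)) * a ^ (k - 1)"
    proof (cases "k = 1")
      case False
      then obtain l where l: "k = Suc (Suc l)" using k False by (intro that[of "k - 2"]) auto
      have "CARD('n) - 1 = Suc m" using k by (simp add: m_def)
      then show ?thesis by (simp add: D_def l algebra_simps)
    qed (simp add: D_def)
  qed
  have E: "E \<ge> 0"
    using mult_left_mono[OF c D] Da by (simp add: E_def)
  have "(\<Sum>i\<in>UNIV. \<Sum>j\<in>UNIV. \<xi>$i * \<xi>$j * Sk_deriv k i j (radial_matrix a b x)) =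
     (\<Sum>i\<in>UNIV. \<Sum>j\<in>UNIV. (if i = j then E * (\<xi>$i * \<xi>$j) else 0) - b * D * ((x$i * \<xi>$i) * (x$j * \<xi>$j)))"
    using k \<open>k < CARD('n)\<close>
    by (intro sum.cong refl) (simp add: Sk_deriv_radial_matrix D_def E_def m_def algebra_simps)
  also have "\<dots> = E * (\<Sum>i\<in>UNIV. \<xi>$i * \<xi>$i) - b * D * ((\<Sum>i\<in>UNIV. x$i * \<xi>$i) * (\<Sum>j\<in>UNIV. x$j * \<xi>$j))"
    unfolding sum_product by (simp add: sum_subtractf sum_distrib_left)
  also have "\<dots> = E * (norm \<xi>)\<^sup>2 - b * D * (x \<bullet> \<xi>)\<^sup>2"
  proof -
    have "(norm \<xi>)\<^sup>2 = (\<Sum>i\<in>UNIV. \<xi>$i * \<xi>$i)"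
      by (simp add: power2_norm_eq_inner inner_vec_def)
    then show ?thesis by (simp add: inner_vec_def power2_eq_square)
  qed
  also have "\<dots> \<ge> E * ((x \<bullet> \<xi>) / norm x)\<^sup>2 - b * D * (x \<bullet> \<xi>)\<^sup>2"
  proof -
    have "\<bar>x \<bullet> \<xi>\<bar> \<le> norm \<xi> * norm x" using Cauchy_Schwarz_ineq2[of x \<xi>] by (simp add: mult.commute)
    then have "\<bar>(x \<bullet> \<xi>) / norm x\<bar> \<le> norm \<xi>"
      using x by (simp add: divide_le_eq)
    then have "((x \<bullet> \<xi>) / norm x)\<^sup>2 \<le> (norm \<xi>)\<^sup>2"
      by (metis abs_norm_cancel abs_le_square_iff)
    then show ?thesis using E by (simp add: mult_left_mono)
  qed
  also have "E * ((x \<bullet> \<xi>) / norm x)\<^sup>2 - b * D * (x \<bullet> \<xi>)\<^sup>2 = (E - b * D * (norm x)\<^sup>2) * ((x \<bullet> \<xi>) / norm x)\<^sup>2"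
    using x by (simp add: field_simps)
  also have "E - b * D * (norm x)\<^sup>2 = (CARD('n) - 1 choose (k - 1)) * a ^ (k - 1)"
    unfolding sum[symmetric] E_def by (simp add: algebra_simps)
  finally show ?thesis .
qed

section \<open>Integration by parts in Euclidean space\<close>

lemma has_derivative_along_axis_shift:
  fixes F :: "real^'n \<Rightarrow> real"
  assumes "((\<lambda>t. F ((x + s *\<^sub>R axis i 1) + t *\<^sub>R axis i 1)) has_real_derivative D) (at 0)"
  shows "((\<lambda>t. F (x + t *\<^sub>R axis i 1)) has_real_derivative D) (at s)"
  using DERIV_shift[of "\<lambda>t. F (x + t *\<^sub>R axis i 1)" D 0 s] assms
  by (simp add: scaleR_add_left add_ac)

lemma has_derivative_along_axis_zero:
  fixes F :: "real^'n \<Rightarrow> real"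
  assumes "open T" "x \<in> T" "\<And>y. y \<in> T \<Longrightarrow> F y = 0"
  shows "((\<lambda>t. F (x + t *\<^sub>R axis i 1)) has_real_derivative 0) (at 0)"
proof -
  have "((\<lambda>t. x + t *\<^sub>R axis i 1) \<longlongrightarrow> x + 0 *\<^sub>R axis i 1) (at 0)"
    by (intro tendsto_intros)
  then have "\<forall>\<^sub>F t in at 0. x + t *\<^sub>R axis i 1 \<in> T"
    by (rule topological_tendstoD) (use assms in auto)
  then have "\<forall>\<^sub>F t in at 0. F (x + t *\<^sub>R axis i 1) = 0"
    by eventually_elim (rule assms)
  then have "\<forall>\<^sub>F t in nhds 0. F (x + t *\<^sub>R axis i 1) = 0"
    using assms by (simp add: eventually_nhds_conv_at)
  then show ?thesis
    by (subst DERIV_cong_ev[where g="\<lambda>_. 0"]) auto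
qed

text \<open>
  By translation invariance all difference quotients of \<open>F\<close> in the direction of the axis have
  integral \<open>0\<close>. They are uniformly bounded by the mean value theorem and vanish outside of a fixed
  ball, so the integral passes to their limit.
\<close>

lemma integral_partial_derivative_eq_0:
  fixes F D :: "real^'n \<Rightarrow> real"
  assumes der: "\<And>x. ((\<lambda>t. F (x + t *\<^sub>R axis i 1)) has_real_derivative D x) (at 0)"
    and contF: "continuous_on UNIV F" and contD: "continuous_on UNIV D"
    and supp: "\<And>x. norm x > R \<Longrightarrow> F x = 0"
  shows "integrable lborel D" "integral\<^sup>L lborel D = 0"
proof -
  have D0: "D x = 0" if x: "norm x > R" for x
  proof -
    have "open {y::real^'n. R < norm y}" by (intro open_Collect_less continuous_intros)
    then have "((\<lambda>t. F (x + t *\<^sub>R axis i 1)) has_real_derivative 0) (at 0)"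
      by (rule has_derivative_along_axis_zero) (use x supp in auto)
    from DERIV_unique[OF der this] show ?thesis .
  qed
  have bnd: "integrable lborel (\<lambda>x. indicator (cball 0 r) x *\<^sub>R G x)"
    if "continuous_on UNIV G" for G :: "real^'n \<Rightarrow> real" and r
    using that by (intro borel_integrable_compact) (auto intro: continuous_on_subset)
  have "(\<lambda>x. indicator (cball 0 R) x *\<^sub>R D x) = D"
    using D0 by (force simp: indicator_def fun_eq_iff)
  with bnd[OF contD, of R] show "integrable lborel D" by simp
  have "(\<lambda>x. indicator (cball 0 R) x *\<^sub>R F x) = F"
    using supp by (force simp: indicator_def fun_eq_iff)
  with bnd[OF contF, of R] have intF: "integrable lborel F" by simp
  have measF[measurable]: "F \<in> borel_measurable borel" and measD[measurable]: "D \<in> borel_measurable borel"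
    using contF contD by (auto intro: borel_measurable_continuous_onI)
  obtain B where B: "\<And>x. \<bar>D x\<bar> \<le> B"
  proof -
    have "bounded (D ` cball 0 R)"
      by (intro compact_imp_bounded compact_continuous_image continuous_on_subset[OF contD]) auto
    then obtain B where "\<forall>x\<in>cball 0 R. \<bar>D x\<bar> \<le> B" unfolding bounded_iff by auto
    then have "\<bar>D x\<bar> \<le> max B 0" for x using D0[of x] by (cases "norm x \<le> R") (force simp: max_def)+
    then show thesis by (rule that)
  qed
  have "B \<ge> 0" using B[of 0] by linarith
  define q where "q = (\<lambda>(m::nat) x. (F (x + inverse (real (Suc m)) *\<^sub>R axis i 1) - F x) / inverse (real (Suc m)))"
  have lim: "(\<lambda>m. q m x) \<longlonglongrightarrow> D x" for x
  proof -
    have "((\<lambda>h. (F (x + h *\<^sub>R axis i 1) - F x) / h) \<longlongrightarrow> D x) (at 0)"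
      using der[of x] by (simp add: DERIV_def)
    moreover have "filterlim (\<lambda>m. inverse (real (Suc m))) (at 0) sequentially"
      using LIMSEQ_inverse_real_of_nat by (auto simp: filterlim_at)
    ultimately show ?thesis
      unfolding q_def by (rule filterlim_compose)
  qed
  have q_le: "\<bar>q m x\<bar> \<le> B" for m x
  proof -
    have h: "0 < inverse (real (Suc m))" by simp
    from MVT2[OF h, of "\<lambda>t. F (x + t *\<^sub>R axis i 1)" "\<lambda>t. D (x + t *\<^sub>R axis i 1)"]
    obtain s where "F (x + inverse (real (Suc m)) *\<^sub>R axis i 1) - F x = inverse (real (Suc m)) * D (x + s *\<^sub>R axis i 1)"
      using has_derivative_along_axis_shift[OF der] by auto
    then have "q m x = D (x + s *\<^sub>R axis i 1)" by (simp add: q_def)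
    then show ?thesis using B by simp
  qed
  have q_supp: "q m x = 0" if "norm x > R + 1" for m x
  proof -
    have "norm x \<le> norm (x + inverse (real (Suc m)) *\<^sub>R axis i 1) + norm (inverse (real (Suc m)) *\<^sub>R (axis i 1 :: real^'n))"
      by (rule order_trans[OF _ norm_triangle_ineq4]) simp
    also have "norm (inverse (real (Suc m)) *\<^sub>R (axis i 1 :: real^'n)) \<le> 1"
      by (simp add: inverse_le_1_iff)
    finally show ?thesis using that by (simp add: q_def supp)
  qed
  have "(\<lambda>m. integral\<^sup>L lborel (q m)) \<longlonglongrightarrow> integral\<^sup>L lborel D"
  proof (rule integral_dominated_convergence)
    show "integrable lborel (\<lambda>x. indicator (cball (0::real^'n) (R + 1)) x *\<^sub>R B)"
      by (intro bnd) auto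
    show "AE x in lborel. norm (q m x) \<le> indicator (cball 0 (R + 1)) x *\<^sub>R B" for m
      using q_le q_supp by (intro AE_I2) (force simp: indicator_def)
    show "q m \<in> borel_measurable lborel" for m
      unfolding q_def by measurable
  qed (use lim in auto)
  moreover have "integral\<^sup>L lborel (q m) = 0" for m
  proof -
    define c where "c = inverse (real (Suc m)) *\<^sub>R (axis i 1 :: real^'n)"
    have "integrable (distr lborel borel ((+) c)) F" "integral\<^sup>L (distr lborel borel ((+) c)) F = integral\<^sup>L lborel F"
      using intF by (simp_all add: lborel_distr_plus)
    then have "integrable lborel (\<lambda>x. F (x + c))" "integral\<^sup>L lborel (\<lambda>x. F (x + c)) = integral\<^sup>L lborel F"
      by (simp_all add: integrable_distr_eq integral_distr add.commute)
    with intF show ?thesis by (simp add: q_def c_def)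
  qed
  ultimately show "integral\<^sup>L lborel D = 0"
    by (simp add: LIMSEQ_const_iff)
qed

lemma set_lebesgue_integral_eq_lborel:
  fixes f :: "real^'n \<Rightarrow> real"
  assumes "f \<in> borel_measurable borel" "\<And>x. x \<notin> \<Omega> \<Longrightarrow> f x = 0"
  shows "(LINT x:\<Omega>|lebesgue. f x) = integral\<^sup>L lborel f"
proof -
  have "(\<lambda>x. indicator \<Omega> x *\<^sub>R f x) = f"
    using assms(2) by (auto simp: fun_eq_iff indicator_def)
  then show ?thesis
    using assms(1) by (simp add: set_lebesgue_integral_def integral_completion)
qed

text \<open>
  On the shell between the radii \<open>2\<close> to the powers \<open>-j-1\<close> and \<open>-j\<close> the integrand is at most
  \<open>2 ^ ((j+1) a)\<close>, and the volume of the ball around it is proportional to \<open>2\<close> to the power \<open>-jn\<close>. The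
  resulting series is geometric with ratio \<open>2 ^ a / 2 ^ n\<close>.
\<close>

lemma set_integrable_inverse_norm_power:
  assumes "a < CARD('n::finite)"
  shows "set_integrable lborel (ball 0 1) (\<lambda>x::real^'n. inverse (norm x ^ a))"
proof -
  define V where "V = measure lborel (ball (0::real^'n) 1)"
  define f where "f = (\<lambda>(j::nat) (x::real^'n). ennreal (2 ^ (Suc j * a)) * indicator (ball 0 ((1/2)^j)) x)"
  have le: "ennreal (norm (indicator (ball 0 1) x *\<^sub>R inverse (norm x ^ a))) \<le> (\<Sum>j. f j x)" if x0: "x \<noteq> 0" for x :: "real^'n"
  proof (cases "norm x < 1")
    case True
    define j where "j = (LEAST j. (1/2)^Suc j \<le> norm x)"
    obtain j0 :: nat where "(1/2)^j0 < norm x"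
      using real_arch_pow_inv[of "norm x" "1/2"] x0 by auto
    then have "(1/2::real)^Suc j0 \<le> norm x"
      by (rule order_trans[OF power_decreasing less_imp_le, rotated -1]) auto
    then have j: "(1/2)^Suc j \<le> norm x"
      unfolding j_def by (rule LeastI)
    have "norm x < (1/2)^j"
    proof (cases j)
      case (Suc i)
      then have "\<not> (1/2)^Suc i \<le> norm x"
        using not_less_Least[of i "\<lambda>j. (1/2)^Suc j \<le> norm x"] unfolding j_def by simp
      then show ?thesis using Suc by simp
    qed (use True in simp)
    moreover have "inverse (norm x ^ a) \<le> 2 ^ (Suc j * a)"
    proof -
      have "inverse (norm x ^ a) \<le> inverse (((1/2)^Suc j) ^ a)"
        using j by (intro le_imp_inverse_le power_mono) auto
      also have "inverse (((1/2::real)^Suc j) ^ a) = 2 ^ (Suc j * a)"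
        by (simp only: power_mult power_one_over inverse_eq_divide) (simp del: power_Suc)
      finally show ?thesis .
    qed
    ultimately have "ennreal (norm (indicator (ball 0 1) x *\<^sub>R inverse (norm x ^ a))) \<le> f j x"
      using True by (simp add: f_def ennreal_leI)
    also have "\<dots> \<le> (\<Sum>j. f j x)"
      using sum_le_suminf[of "\<lambda>j. f j x" "{j}"] by simp
    finally show ?thesis .
  qed simp
  define c where "c = 2 ^ a * V"
  have c: "c \<ge> 0" by (simp add: c_def V_def)
  have [measurable]: "f j \<in> borel_measurable borel" for j
    unfolding f_def by (intro borel_measurable_times_ennreal borel_measurable_const borel_measurable_indicator) auto
  have "(\<integral>\<^sup>+ x. ennreal (norm (indicator (ball 0 1) (x::real^'n) *\<^sub>R inverse (norm x ^ a))) \<partial>lborel) \<le> (\<integral>\<^sup>+ x. (\<Sum>j. f j x) \<partial>lborel)"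
  proof (rule nn_integral_mono_AE)
    show "AE x in lborel. ennreal (norm (indicator (ball 0 1) (x::real^'n) *\<^sub>R inverse (norm x ^ a))) \<le> (\<Sum>j. f j x)"
      using AE_lborel_singleton[of 0] by eventually_elim (rule le)
  qed
  also have "\<dots> = (\<Sum>j. \<integral>\<^sup>+ x. f j x \<partial>lborel)"
    by (rule nn_integral_suminf) measurable
  also have "\<dots> = (\<Sum>j. ennreal (c * (2 ^ a / 2 ^ CARD('n)) ^ j))"
  proof (rule suminf_cong)
    fix j
    have "emeasure lborel (ball (0::real^'n) ((1/2)^j)) = ennreal (((1/2)^j)^CARD('n) * V)"
      using content_ball_conv_unit_ball[of "(1/2)^j" "0::real^'n"] emeasure_lborel_ball_finite[of "0::real^'n" "(1/2)^j"]
      by (simp add: V_def emeasure_eq_ennreal_measure)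
    then have "(\<integral>\<^sup>+ x. f j x \<partial>lborel) = ennreal (2 ^ (Suc j * a)) * ennreal (((1/2)^j)^CARD('n) * V)"
      by (simp add: f_def nn_integral_cmult_indicator)
    also have "\<dots> = ennreal (2 ^ (Suc j * a) * (((1/2)^j)^CARD('n) * V))"
      by (simp add: ennreal_mult V_def)
    also have "2 ^ (Suc j * a) * (((1/2)^j)^CARD('n) * V) = c * (2 ^ a / 2 ^ CARD('n)) ^ j"
      by (simp add: c_def power_divide power_add power_mult[symmetric] mult.commute)
    finally show "(\<integral>\<^sup>+ x. f j x \<partial>lborel) = \<dots>" .
  qed
  also have "\<dots> = ennreal (c * (1 / (1 - 2 ^ a / 2 ^ CARD('n))))"
    using assms c by (intro suminf_ennreal_eq sums_mult geometric_sums) (auto simp: power_strict_increasing)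
  also have "\<dots> < \<infinity>" by simp
  finally show ?thesis
    unfolding set_integrable_def
    by (intro integrableI_bounded borel_measurable_scaleR borel_measurable_indicator) auto
qed

lemma has_real_derivative_norm_along_axis:
  fixes x :: "real^'n"
  assumes "x \<noteq> 0"
  shows "((\<lambda>t. norm (x + t *\<^sub>R axis i 1)) has_real_derivative x$i / norm x) (at 0)"
proof -
  have "((\<lambda>t. x + t *\<^sub>R axis i 1) has_derivative (\<lambda>t. t *\<^sub>R axis i 1)) (at 0)"
    by (auto intro!: derivative_eq_intros)
  moreover have "(norm has_derivative (\<lambda>h. h \<bullet> sgn x)) (at (x + 0 *\<^sub>R axis i 1))"
    using has_derivative_norm[OF assms] by simp
  ultimately have "((\<lambda>t. norm (x + t *\<^sub>R axis i 1)) has_derivative (\<lambda>t. (t *\<^sub>R axis i 1) \<bullet> sgn x)) (at 0)"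
    by (rule has_derivative_compose)
  moreover have "(\<lambda>t. (t *\<^sub>R axis i 1) \<bullet> sgn x) = (*) (x$i / norm x)"
    by (auto simp: fun_eq_iff sgn_div_norm inner_axis' divide_inverse)
  ultimately show ?thesis by (simp add: has_field_derivative_def)
qed

lemma has_real_derivative_radial:
  fixes x :: "real^'n"
  assumes "x \<noteq> 0" "(h has_real_derivative h') (at (norm x))"
  shows "((\<lambda>t. h (norm (x + t *\<^sub>R axis i 1))) has_real_derivative h' * (x$i / norm x)) (at 0)"
  by (rule DERIV_chain2) (use assms has_real_derivative_norm_along_axis[OF assms(1)] in simp_all)

lemma has_real_derivative_component_along_axis:
  "((\<lambda>t. (x + t *\<^sub>R axis i 1)$j) has_real_derivative (if i = j then 1 else 0)) (at 0)"
  by (auto intro!: derivative_eq_intros simp: axis_def)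

lemma has_partial_derivative:
  assumes "\<psi> differentiable_on UNIV"
  shows "((\<lambda>t. \<psi> (x + t *\<^sub>R axis i 1)) has_real_derivative partial_derivative i \<psi> x) (at 0)"
proof -
  obtain L where "(\<psi> has_derivative L) (at (x + 0 *\<^sub>R axis i 1))"
    using assms by (auto simp: differentiable_on_def differentiable_def)
  moreover have "((\<lambda>t. x + t *\<^sub>R axis i 1) has_derivative (\<lambda>t. t *\<^sub>R axis i 1)) (at 0)"
    by (auto intro!: derivative_eq_intros)
  ultimately have "(\<lambda>t. \<psi> (x + t *\<^sub>R axis i 1)) differentiable (at 0)"
    using has_derivative_compose differentiableI by blast
  then show ?thesis
    unfolding partial_derivative_def using DERIV_deriv_iff_real_differentiable by blast
qed

lemma test_function_outside_support:
  assumes "x \<notin> closure {x. \<psi> x \<noteq> 0}"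
  shows "\<psi> x = 0" "partial_derivative i \<psi> x = 0"
proof -
  show "\<psi> x = 0" using assms closure_subset[of "{x. \<psi> x \<noteq> 0}"] by auto
  have "((\<lambda>t. \<psi> (x + t *\<^sub>R axis i 1)) has_real_derivative 0) (at 0)"
    using assms closure_subset[of "{x. \<psi> x \<noteq> 0}"]
    by (intro has_derivative_along_axis_zero[of "- closure {x. \<psi> x \<noteq> 0}"]) auto
  then show "partial_derivative i \<psi> x = 0"
    unfolding partial_derivative_def by (rule DERIV_imp_deriv)
qed

lemma test_function_continuous:
  assumes "test_function \<Omega> \<psi>"
  shows "continuous_on UNIV \<psi>" "continuous_on UNIV (partial_derivative i \<psi>)"
  using assms differentiable_imp_continuous_on by (auto simp: test_function_def)

lemma test_function_bounded:
  assumes "test_function \<Omega> \<psi>"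
  obtains B where "B \<ge> 0" "\<And>x. \<bar>\<psi> x\<bar> \<le> B" "\<And>x. \<bar>partial_derivative i \<psi> x\<bar> \<le> B"
proof -
  define T where "T = closure {x. \<psi> x \<noteq> 0}"
  have "compact T" using assms by (simp add: test_function_def T_def)
  then have "bounded (\<psi> ` T)" "bounded (partial_derivative i \<psi> ` T)"
    by (auto intro!: compact_imp_bounded compact_continuous_image
        intro: continuous_on_subset[OF test_function_continuous(1)[OF assms]]
         continuous_on_subset[OF test_function_continuous(2)[OF assms]])
  then obtain B1 B2 where B: "\<forall>x\<in>T. \<bar>\<psi> x\<bar> \<le> B1" "\<forall>x\<in>T. \<bar>partial_derivative i \<psi> x\<bar> \<le> B2"
    unfolding bounded_iff by auto
  define B where "B = max 0 (max B1 B2)"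
  have "\<bar>\<psi> x\<bar> \<le> B \<and> \<bar>partial_derivative i \<psi> x\<bar> \<le> B" for x
    using B test_function_outside_support(1)[of x \<psi>] test_function_outside_support(2)[of x \<psi> i]
    by (cases "x \<in> T") (force simp: B_def T_def)+
  then show thesis by (intro that[of B]) (auto simp: B_def)
qed

text \<open>
  \<open>Div\<close> is the divergence of the field \<open>f(|x|) \<psi>\<^sup>2 x\<close>. The singularity of \<open>f\<close> at the origin is
  harmless because \<open>\<psi>\<close> vanishes in a neighbourhood of it.
\<close>

lemma integral_divergence_radial_field:
  fixes \<psi> :: "real^'n \<Rightarrow> real" and f f' :: "real \<Rightarrow> real"
  assumes \<psi>: "test_function \<Omega> \<psi>" "0 \<notin> \<Omega>"
    and f: "\<And>r. r > 0 \<Longrightarrow> (f has_real_derivative f' r) (at r)"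
    and f': "continuous_on {0<..} f'"
  defines "Div \<equiv> \<lambda>x. (\<psi> x)\<^sup>2 * (CARD('n) * f (norm x) + norm x * f' (norm x)) +
      2 * f (norm x) * \<psi> x * (\<Sum>i\<in>UNIV. x$i * partial_derivative i \<psi> x)"
  shows "integrable lborel Div" "integral\<^sup>L lborel Div = 0"
proof -
  define T where "T = closure {x. \<psi> x \<noteq> 0}"
  have T: "compact T" "0 \<notin> T" "closed T" using \<psi> by (auto simp: test_function_def T_def)
  have out: "\<psi> x = 0" "partial_derivative i \<psi> x = 0" if "x \<notin> T" for x i
    using test_function_outside_support(1)[of x \<psi>] test_function_outside_support(2)[of x \<psi> i] that
    by (auto simp: T_def)
  obtain R where R: "\<And>x. x \<in> T \<Longrightarrow> norm x \<le> R"
    using compact_imp_bounded[OF T(1)] unfolding bounded_iff by auto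
  define F where "F = (\<lambda>i x. x$i * f (norm x) * (\<psi> x)\<^sup>2)"
  define G where "G = (\<lambda>i x. (\<psi> x)\<^sup>2 * (f (norm x) + (x$i)\<^sup>2 * f' (norm x) / norm x) +
      2 * f (norm x) * \<psi> x * (x$i * partial_derivative i \<psi> x))"
  have contf: "continuous_on {0<..} f"
    by (rule DERIV_continuous_on[of _ f f']) (auto intro: has_field_derivative_at_within f)
  have contfn: "continuous_on (- {0}) (\<lambda>x::real^'n. f (norm x))"
    "continuous_on (- {0}) (\<lambda>x::real^'n. f' (norm x))"
    by (rule continuous_on_compose2[OF contf] continuous_on_compose2[OF f']; auto intro!: continuous_intros)+
  have cont\<psi>: "continuous_on S \<psi>" "continuous_on S (partial_derivative i \<psi>)" for S i
    using test_function_continuous[OF \<psi>(1)] continuous_on_subset by blast+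
  have glue: "continuous_on UNIV H" if "continuous_on (- {0}) H" "\<And>x. x \<notin> T \<Longrightarrow> H x = 0" for H :: "real^'n \<Rightarrow> real"
  proof -
    have "continuous_on (- T) H"
      using that(2) by (subst continuous_on_cong[OF refl, of _ _ "\<lambda>_. 0"]) auto
    then have "continuous_on (- {0} \<union> - T) H"
      using that(1) T by (intro continuous_on_open_Un) auto
    moreover have "- {0} \<union> - T = UNIV" using T by auto
    ultimately show ?thesis by simp
  qed
  have contF: "continuous_on UNIV (F i)" for i
    unfolding F_def by (rule glue) (auto intro!: continuous_intros contfn cont\<psi> simp: out)
  have contG: "continuous_on UNIV (G i)" for i
    unfolding G_def by (rule glue) (auto intro!: continuous_intros contfn cont\<psi> simp: out)
  have der: "((\<lambda>t. F i (x + t *\<^sub>R axis i 1)) has_real_derivative G i x) (at 0)" for i x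
  proof (cases "x \<in> T")
    case False
    then have "G i x = 0" by (simp add: G_def out)
    then show ?thesis
      using False T by (simp, intro has_derivative_along_axis_zero[of "- T"]) (auto simp: F_def out)
  next
    case True
    then have x: "x \<noteq> 0" using T by auto
    have "((\<lambda>t. (x + t *\<^sub>R axis i 1)$i * f (norm (x + t *\<^sub>R axis i 1)) * (\<psi> (x + t *\<^sub>R axis i 1))\<^sup>2)
        has_real_derivative G i x) (at 0)"
      by (rule DERIV_cong[OF DERIV_mult[OF DERIV_mult[OF has_real_derivative_component_along_axis
              has_real_derivative_radial[OF x f]] DERIV_power[OF has_partial_derivative, where n=2]]])
        (use x \<psi>(1) in \<open>auto simp: test_function_def G_def power2_eq_square field_simps\<close>)
    then show ?thesis by (simp add: F_def)
  qed
  have supp: "F i x = 0" if "norm x > R" for i x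
    using R[of x] that by (force simp: F_def out)
  have G: "integrable lborel (G i)" "integral\<^sup>L lborel (G i) = 0" for i
    using integral_partial_derivative_eq_0[OF der contF contG supp] by auto
  have "Div x = (\<Sum>i\<in>UNIV. G i x)" for x
  proof -
    have "(\<Sum>i\<in>UNIV. G i x) = (\<psi> x)\<^sup>2 * (CARD('n) * f (norm x) + (\<Sum>i\<in>UNIV. (x$i)\<^sup>2) * (f' (norm x) / norm x)) +
        2 * f (norm x) * \<psi> x * (\<Sum>i\<in>UNIV. x$i * partial_derivative i \<psi> x)"
      by (simp add: G_def sum.distrib sum_distrib_left sum_distrib_right distrib_left mult_ac)
    also have "(\<Sum>i\<in>UNIV. (x$i)\<^sup>2) = (norm x)\<^sup>2"
      unfolding power2_norm_eq_inner inner_vec_def by (simp add: power2_eq_square)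
    finally show ?thesis by (simp add: Div_def power2_eq_square)
  qed
  then have "Div = (\<lambda>x. \<Sum>i\<in>UNIV. G i x)" by auto
  then show "integrable lborel Div" "integral\<^sup>L lborel Div = 0"
    using G by simp_all
qed

lemma partial_derivative_radial:
  fixes x :: "real^'n"
  assumes "x \<noteq> 0" "(U has_real_derivative D) (at (norm x))"
  shows "partial_derivative i (\<lambda>x. U (norm x)) x = D / norm x * x$i"
  unfolding partial_derivative_def
  using DERIV_imp_deriv[OF has_real_derivative_radial[OF assms]] by simp

lemma hessian_radial:
  fixes x :: "real^'n"
  assumes x: "x \<noteq> 0" and U: "\<And>r. r > 0 \<Longrightarrow> (U has_real_derivative r * a r) (at r)"
    and a: "(a has_real_derivative a') (at (norm x))"
  shows "hessian (\<lambda>x. U (norm x)) x = radial_matrix (a (norm x)) (a' / norm x) x"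
proof -
  have pd: "partial_derivative i (\<lambda>x. U (norm x)) y = a (norm y) * y$i" if "y \<noteq> 0" for y :: "real^'n" and i
    using partial_derivative_radial[OF that U] that by simp
  have "partial_derivative j (partial_derivative i (\<lambda>x. U (norm x))) x =
      (if i = j then a (norm x) else 0) + a' / norm x * (x$i * x$j)" for i j
  proof -
    have der: "((\<lambda>t. a (norm (x + t *\<^sub>R axis j 1)) * (x + t *\<^sub>R axis j 1)$i) has_real_derivative
       (if i = j then a (norm x) else 0) + a' / norm x * (x$i * x$j)) (at 0)"
      by (rule DERIV_cong[OF DERIV_mult[OF has_real_derivative_radial[OF x a] has_real_derivative_component_along_axis]])
        (auto simp: mult_ac)
    have ev: "\<forall>\<^sub>F t in nhds 0. partial_derivative i (\<lambda>x. U (norm x)) (x + t *\<^sub>R axis j 1) =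
        a (norm (x + t *\<^sub>R axis j 1)) * (x + t *\<^sub>R axis j 1)$i"
    proof -
      have "((\<lambda>t. x + t *\<^sub>R axis j 1) \<longlongrightarrow> x + 0 *\<^sub>R axis j 1) (at 0)"
        by (intro tendsto_intros)
      then have "\<forall>\<^sub>F t in at 0. x + t *\<^sub>R axis j 1 \<in> - {0}"
        by (rule topological_tendstoD) (use x in auto)
      then have "\<forall>\<^sub>F t in nhds 0. x + t *\<^sub>R axis j 1 \<in> - {0}"
        using x by (simp add: eventually_nhds_conv_at)
      then show ?thesis by eventually_elim (rule pd, simp)
    qed
    have "((\<lambda>t. partial_derivative i (\<lambda>x. U (norm x)) (x + t *\<^sub>R axis j 1)) has_real_derivative
       (if i = j then a (norm x) else 0) + a' / norm x * (x$i * x$j)) (at 0)"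
      by (rule DERIV_cong_ev[OF refl ev refl, THEN iffD2, OF der])
    then show ?thesis
      unfolding partial_derivative_def[of j] by (rule DERIV_imp_deriv)
  qed
  then show ?thesis by (simp add: hessian_def radial_matrix_def vec_eq_iff)
qed

section \<open>Concave functions with prescribed steep slopes\<close>

text \<open>
  A smooth version of the concave corner \<open>min 0 (2 s)\<close>, up to a bounded error. Rescaled copies
  change their slope by a fixed small amount in an arbitrarily short interval.
\<close>

definition bend :: "real \<Rightarrow> real" where "bend s = s - sqrt (1 + s\<^sup>2)"
definition bend' :: "real \<Rightarrow> real" where "bend' s = 1 - s / sqrt (1 + s\<^sup>2)"
definition bend'' :: "real \<Rightarrow> real" where "bend'' s = - 1 / sqrt (1 + s\<^sup>2) ^ 3"

lemma one_plus_square_pos: "0 < 1 + (s::real)\<^sup>2"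
  by (simp add: add_pos_nonneg)

lemma bend_has_derivative: "(bend has_real_derivative bend' s) (at s)"
  unfolding bend_def[abs_def] bend'_def using one_plus_square_pos[of s]
  by (auto intro!: derivative_eq_intros simp: field_simps)

lemma bend'_has_derivative: "(bend' has_real_derivative bend'' s) (at s)"
proof -
  define h where "h = sqrt (1 + s\<^sup>2)"
  have h: "h > 0" "h\<^sup>2 = 1 + s\<^sup>2" using one_plus_square_pos[of s] by (auto simp: h_def)
  have dh: "((\<lambda>s. sqrt (1 + s\<^sup>2)) has_real_derivative s / h) (at s)"
    using one_plus_square_pos[of s] by (auto intro!: derivative_eq_intros simp: h_def field_simps)
  have "(bend' has_real_derivative 0 - (1 * h - s * (s / h)) / (h * h)) (at s)"
    unfolding bend'_def[abs_def]
    using DERIV_diff[OF DERIV_const DERIV_divide[OF DERIV_ident dh]] h(1) by (simp add: h_def)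
  moreover have "0 - (1 * h - s * (s / h)) / (h * h) = - (h\<^sup>2 - s\<^sup>2) / h ^ 3"
    using h(1) by (simp add: field_simps power2_eq_square power3_eq_cube)
  ultimately show ?thesis using h(2) by (simp add: bend''_def h_def)
qed

lemma bend'_bounds: "0 \<le> bend' s" "bend' s \<le> 2"
proof -
  have "\<bar>s\<bar> \<le> sqrt (1 + s\<^sup>2)" by (rule real_le_rsqrt) simp
  then have "\<bar>s / sqrt (1 + s\<^sup>2)\<bar> \<le> 1"
    using one_plus_square_pos[of s] by (simp add: divide_le_eq)
  then show "0 \<le> bend' s" "bend' s \<le> 2" unfolding bend'_def by linarith+
qed

lemma bend''_bounds: "bend'' s \<le> 0" "\<bar>bend'' s\<bar> \<le> 1" "\<bar>bend'' s\<bar> \<le> 1 / (1 + s\<^sup>2)"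
proof -
  define h where "h = sqrt (1 + s\<^sup>2)"
  have h: "h \<ge> 1" "h\<^sup>2 = 1 + s\<^sup>2" using one_plus_square_pos[of s] by (auto simp: h_def)
  have eq: "\<bar>bend'' s\<bar> = 1 / h ^ 3" using h(1) by (simp add: bend''_def h_def)
  show "bend'' s \<le> 0" using h(1) by (simp add: bend''_def h_def)
  show "\<bar>bend'' s\<bar> \<le> 1" unfolding eq using h(1) by (simp add: one_le_power)
  have "h ^ 2 \<le> h ^ 3" using h(1) by (intro power_increasing) auto
  then show "\<bar>bend'' s\<bar> \<le> 1 / (1 + s\<^sup>2)"
    unfolding eq h(2)[symmetric] using h(1) by (intro divide_left_mono) auto
qed

text \<open>
  For an increasing concave function with slope at most \<open>2\<close>, the increment over an interval lies
  between the slope at the right end and \<open>2\<close>, times the length. Here this is checked from the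
  formula: the first bound is the triangle inequality and the second is Cauchy-Schwarz for the
  plane vectors \<open>(1, s)\<close> and \<open>(1, -s0)\<close>.
\<close>

lemma bend_increment:
  assumes "s + s0 \<ge> 0"
  shows "bend s - bend (- s0) \<le> 2 * (s + s0)" "(s + s0) * bend' s \<le> bend s - bend (- s0)"
proof -
  have "sqrt ((0 + 1)\<^sup>2 + ((s + s0) + (- s))\<^sup>2) \<le> sqrt (0\<^sup>2 + (s + s0)\<^sup>2) + sqrt (1\<^sup>2 + (- s)\<^sup>2)"
    by (rule real_sqrt_sum_squares_triangle_ineq)
  then have "sqrt (1 + s0\<^sup>2) \<le> (s + s0) + sqrt (1 + s\<^sup>2)"
    using assms by simp
  then show "bend s - bend (- s0) \<le> 2 * (s + s0)" by (simp add: bend_def)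
  define h where "h = sqrt (1 + s\<^sup>2)"
  have h: "h > 0" "h\<^sup>2 = 1 + s\<^sup>2" using one_plus_square_pos[of s] by (auto simp: h_def)
  have "(1 - s0 * s)\<^sup>2 \<le> (1 + s0\<^sup>2) * (1 + s\<^sup>2)"
    using zero_le_power2[of "s + s0"] by (simp add: power2_eq_square algebra_simps)
  then have "1 - s0 * s \<le> sqrt ((1 + s0\<^sup>2) * (1 + s\<^sup>2))"
    by (rule real_le_rsqrt)
  then have "h\<^sup>2 - s\<^sup>2 - s0 * s \<le> sqrt (1 + s0\<^sup>2) * h"
    by (simp add: h(2) h_def real_sqrt_mult)
  then have "h - sqrt (1 + s0\<^sup>2) \<le> (s + s0) * s / h"
    using h(1) by (simp add: field_simps power2_eq_square)
  then show "(s + s0) * bend' s \<le> bend s - bend (- s0)"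
    by (simp add: bend_def bend'_def h_def algebra_simps)
qed

text \<open>
  The \<open>m\<close>-th summand bends at \<open>1/(m+1)\<close> with second derivative \<open>- max 1 (K m)\<close> there, while its
  first derivative is at most \<open>2 e\<^sub>m = 2 / 2 ^ m\<close>. On \<open>(b,\<infinity>)\<close> with \<open>b > 0\<close>, all but finitely many
  corners are at distance at least \<open>b/2\<close>, where the second derivatives decay like \<open>e\<^sub>m / L\<^sub>m\<close>; hence the
  series may be differentiated twice. Each summand vanishes at the origin and is concave, which
  gives \<open>r w \<le> v\<close>.
\<close>

lemma exists_concave_function_with_large_second_derivative:
  fixes K :: "nat \<Rightarrow> real"
  obtains v w d where
    "\<And>r. r > 0 \<Longrightarrow> (v has_real_derivative w r) (at r)"
    "\<And>r. r > 0 \<Longrightarrow> (w has_real_derivative d r) (at r)"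
    "continuous_on {0<..} d"
    "\<And>r. r > 0 \<Longrightarrow> 1 \<le> v r" "\<And>r. r > 0 \<Longrightarrow> v r \<le> 1 + 4 * r"
    "\<And>r. r > 0 \<Longrightarrow> 0 \<le> w r" "\<And>r. r > 0 \<Longrightarrow> r * w r \<le> v r"
    "\<And>r. r > 0 \<Longrightarrow> d r \<le> 0"
    "\<And>m. d (1 / real (Suc m)) \<le> - K m"
proof -
  define e where "e = (\<lambda>m. (1/2::real) ^ m)"
  \<comment> \<open>The second derivative of summand \<open>m\<close> at its corner is \<open>- e m * L m\<close>.\<close>
  define L where "L = (\<lambda>m. max 1 (K m) / e m)"
  define a where "a = (\<lambda>m. 1 / real (Suc m))"
  define V where "V = (\<lambda>m r. e m / L m * (bend (L m * (r - a m)) - bend (- (L m * a m))))"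
  define W where "W = (\<lambda>m r. e m * bend' (L m * (r - a m)))"
  define D where "D = (\<lambda>m r. e m * L m * bend'' (L m * (r - a m)))"
  have e: "0 < e m" "e m \<le> 1" for m by (auto simp: e_def power_le_one)
  have L: "1 \<le> L m" "e m * L m = max 1 (K m)" for m
    using e[of m] by (auto simp: L_def le_divide_eq)
  have L0: "L m > 0" for m using L(1)[of m] by linarith
  have sum_e: "summable e" "suminf e = 2"
    unfolding e_def using geometric_sums[of "1/2::real"] by (auto simp: sums_iff)
  have dV: "(V m has_real_derivative W m r) (at r)" for m r
  proof -
    have "((\<lambda>r. bend (L m * (r - a m))) has_real_derivative bend' (L m * (r - a m)) * L m) (at r)"
      by (rule DERIV_chain2[OF bend_has_derivative]) (auto intro!: derivative_eq_intros)
    then have "(V m has_real_derivative e m / L m * (bend' (L m * (r - a m)) * L m - 0)) (at r)"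
      unfolding V_def by (intro DERIV_cmult DERIV_diff) auto
    then show ?thesis using L0[of m] by (simp add: W_def)
  qed
  have dW: "(W m has_real_derivative D m r) (at r)" for m r
  proof -
    have "((\<lambda>r. bend' (L m * (r - a m))) has_real_derivative bend'' (L m * (r - a m)) * L m) (at r)"
      by (rule DERIV_chain2[OF bend'_has_derivative]) (auto intro!: derivative_eq_intros)
    then have "(W m has_real_derivative e m * (bend'' (L m * (r - a m)) * L m)) (at r)"
      unfolding W_def by (intro DERIV_cmult)
    then show ?thesis by (simp add: D_def mult_ac)
  qed
  have W: "0 \<le> W m r" "W m r \<le> 2 * e m" for m r
    using bend'_bounds[of "L m * (r - a m)"] e[of m] by (auto simp: W_def)
  have V: "V m r \<le> 2 * e m * r" "r * W m r \<le> V m r" "0 \<le> V m r" if "r > 0" for m r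
  proof -
    have eq: "L m * (r - a m) + L m * a m = L m * r" by (simp add: algebra_simps)
    have "L m * (r - a m) + L m * a m \<ge> 0"
      unfolding eq using that L0[of m] by simp
    note incr = bend_increment[OF this, unfolded eq]
    have c: "0 \<le> e m / L m" using e(1)[of m] L0[of m] by simp
    show "V m r \<le> 2 * e m * r"
      using mult_left_mono[OF incr(1) c] L0[of m] by (simp add: V_def mult_ac)
    show *: "r * W m r \<le> V m r"
      using mult_left_mono[OF incr(2) c] L0[of m] by (simp add: V_def W_def mult_ac)
    show "0 \<le> V m r" using W(1)[of m r] that by (intro order_trans[OF _ *]) simp
  qed
  have D: "D m r \<le> 0" for m r
    using bend''_bounds(1)[of "L m * (r - a m)"] e[of m] L0[of m]
    by (simp add: D_def mult_nonneg_nonpos)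
  have D_le: "\<bar>D m r\<bar> \<le> (if a m < b / 2 then e m * (4 / b\<^sup>2) else e m * L m)" if "b > 0" "r > b" for m r b
  proof (cases "a m < b / 2")
    case True
    define s where "s = L m * (r - a m)"
    have s: "s \<ge> L m * (b / 2)"
      unfolding s_def using True that L0[of m] by (intro mult_left_mono) auto
    have "(L m * (b / 2))\<^sup>2 \<le> s\<^sup>2"
      using s that L0[of m] by (intro power_mono) auto
    have "(b / 2)\<^sup>2 \<le> L m * (b / 2)\<^sup>2" using mult_right_mono[OF L(1)[of m], of "(b / 2)\<^sup>2"] by simp
    then have "L m * (b / 2)\<^sup>2 \<le> (L m * (b / 2))\<^sup>2"
      using mult_left_mono[of "(b / 2)\<^sup>2" "L m * (b / 2)\<^sup>2" "L m"] L0[of m]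
      by (simp add: power2_eq_square mult_ac)
    have "\<bar>D m r\<bar> = e m * L m * \<bar>bend'' s\<bar>"
      using e(1)[of m] L0[of m] by (simp add: D_def abs_mult s_def)
    also have "\<dots> \<le> e m * L m * (1 / (1 + s\<^sup>2))"
      using e(1)[of m] L0[of m] by (intro mult_left_mono bend''_bounds) auto
    also have "\<dots> \<le> e m * L m * (1 / (L m * (b / 2)\<^sup>2))"
      using e(1)[of m] L0[of m] \<open>(L m * (b / 2))\<^sup>2 \<le> s\<^sup>2\<close> \<open>L m * (b / 2)\<^sup>2 \<le> (L m * (b / 2))\<^sup>2\<close> that
      by (intro mult_left_mono divide_left_mono mult_pos_pos one_plus_square_pos) auto
    also have "\<dots> = e m * (4 / b\<^sup>2)"
      using L0[of m] by (simp add: field_simps power2_eq_square)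
    finally show ?thesis using True by simp
  next
    case False
    have "\<bar>D m r\<bar> \<le> e m * L m * 1"
      unfolding D_def abs_mult using e(1)[of m] L0[of m] by (intro mult_mono bend''_bounds) auto
    then show ?thesis using False by simp
  qed
  have unif_W: "uniformly_convergent_on {0<..} (\<lambda>n r. \<Sum>m<n. W m r)"
    by (rule Weierstrass_m_test'[where M="\<lambda>m. 2 * e m"])
      (use W sum_e(1) in \<open>auto intro: summable_mult\<close>)
  have unif_D: "uniformly_convergent_on {b<..} (\<lambda>n r. \<Sum>m<n. D m r)" if "b > 0" for b
  proof (rule Weierstrass_m_test')
    show "norm (D m r) \<le> (if a m < b / 2 then e m * (4 / b\<^sup>2) else e m * L m)" if "r \<in> {b<..}" for m r
      using D_le[of b r m] that \<open>b > 0\<close> by simp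
    have "a \<longlonglongrightarrow> 0" unfolding a_def using LIMSEQ_inverse_real_of_nat by (simp add: inverse_eq_divide)
    then have "\<forall>\<^sub>F m in sequentially. a m < b / 2"
      using \<open>b > 0\<close> by (intro order_tendstoD) auto
    then have "\<forall>\<^sub>F m in sequentially. (if a m < b / 2 then e m * (4 / b\<^sup>2) else e m * L m) = e m * (4 / b\<^sup>2)"
      by eventually_elim simp
    then show "summable (\<lambda>m. if a m < b / 2 then e m * (4 / b\<^sup>2) else e m * L m)"
      by (rule summable_cong[THEN iffD2]) (rule summable_mult2[OF sum_e(1)])
  qed
  have summable_W: "summable (\<lambda>m. W m r)" for r
    by (rule summable_comparison_test'[where g="\<lambda>m. 2 * e m"]) (use W sum_e(1) in \<open>auto intro: summable_mult\<close>)
  have summable_V: "summable (\<lambda>m. V m r)" if "r > 0" for r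
    by (rule summable_comparison_test'[where g="\<lambda>m. 2 * e m * r"])
      (use V[OF that] sum_e(1) in \<open>auto intro!: summable_mult summable_mult2\<close>)
  define v where "v = (\<lambda>r. 1 + (\<Sum>m. V m r))"
  define w where "w = (\<lambda>r. \<Sum>m. W m r)"
  define d where "d = (\<lambda>r. \<Sum>m. D m r)"
  show thesis
  proof (rule that)
    fix r :: real assume r: "r > 0"
    have "((\<lambda>x. \<Sum>m. V m x) has_real_derivative w r) (at r)"
      unfolding w_def
      by (rule has_field_derivative_series'(2)[where f=V and f'=W and x=r and S="{0<..}" and ?x0.0=1])
        (use r dV unif_W summable_V in \<open>auto intro: has_field_derivative_at_within simp: interior_open\<close>)
    then show "(v has_real_derivative w r) (at r)"
      unfolding v_def by (auto intro!: derivative_eq_intros)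
    show "(w has_real_derivative d r) (at r)"
      unfolding w_def d_def
      by (rule has_field_derivative_series'(2)[where f=W and f'=D and x=r and S="{r/2<..}" and ?x0.0=r])
        (use r dW unif_D[of "r/2"] summable_W in \<open>auto intro: has_field_derivative_at_within simp: interior_open\<close>)
    show "1 \<le> v r"
      unfolding v_def using V(3)[OF r] by (simp add: suminf_nonneg summable_V[OF r])
    have "(\<Sum>m. V m r) \<le> (\<Sum>m. (2 * r) * e m)"
      using V(1)[OF r] sum_e(1) by (intro suminf_le summable_V[OF r] summable_mult) (auto simp: mult_ac)
    then show "v r \<le> 1 + 4 * r"
      using sum_e by (simp add: v_def suminf_mult)
    show "0 \<le> w r" unfolding w_def using W(1) by (simp add: suminf_nonneg summable_W)
    have "r * w r = (\<Sum>m. r * W m r)" unfolding w_def by (rule suminf_mult[OF summable_W, symmetric])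
    also have "\<dots> \<le> (\<Sum>m. V m r)"
      using V(2)[OF r] by (intro suminf_le summable_V[OF r] summable_mult summable_W) auto
    finally show "r * w r \<le> v r" by (simp add: v_def)
  next
    have sD: "summable (\<lambda>m. D m r)" if "r > 0" for r
    proof -
      have "convergent (\<lambda>n. \<Sum>m<n. D m r)"
        using uniformly_convergent_imp_convergent[OF unif_D[of "r/2"], of r] that by simp
      then show ?thesis by (simp add: summable_iff_convergent)
    qed
    show "d r \<le> 0" if "r > 0" for r
      unfolding d_def using D sD[OF that] by (simp add: suminf_le_const sum_nonpos)
    show "d (1 / real (Suc m)) \<le> - K m" for m
    proof -
      have pos: "0 < a m" by (simp add: a_def)
      have "K m \<le> - D m (a m)"
        using L(2)[of m] by (simp add: D_def bend''_def)
      also have "\<dots> = (\<Sum>i\<in>{m}. - D i (a m))" by simp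
      also have "\<dots> \<le> (\<Sum>i. - D i (a m))"
        using D by (intro sum_le_suminf summable_minus sD pos) auto
      also have "\<dots> = - d (a m)"
        unfolding d_def by (rule suminf_minus[OF sD[OF pos]])
      finally show ?thesis by (simp add: a_def)
    qed
    have "continuous_on {b<..} d" if "b > 0" for b
    proof (rule uniform_limit_theorem)
      show "uniform_limit {b<..} (\<lambda>n r. \<Sum>m<n. D m r) d sequentially"
        using unif_D[OF that] unfolding d_def by (simp add: uniformly_convergent_uniform_limit_iff suminf_eq_lim)
      have "isCont (\<lambda>s. bend'' s) s" for s
        unfolding bend''_def using one_plus_square_pos[of s] by (intro continuous_intros) auto
      then have "continuous_on UNIV bend''"
        by (simp add: continuous_on_eq_continuous_at)
      then have "continuous_on {b<..} (\<lambda>r. bend'' (L m * (r - a m)))" for m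
        by (rule continuous_on_compose2) (auto intro!: continuous_intros)
      then have "continuous_on {b<..} (D m)" for m
        unfolding D_def by (rule continuous_on_mult_left)
      then show "\<forall>\<^sub>F n in sequentially. continuous_on {b<..} (\<lambda>r. \<Sum>m<n. D m r)"
        by (intro always_eventually allI continuous_on_sum) auto
    qed simp
    then have "isCont d r" if "r > 0" for r
      using that continuous_on_eq_continuous_at[of "{r/2<..}" d] by auto
    then show "continuous_on {0<..} d"
      by (simp add: continuous_at_imp_continuous_on)
  qed
qed

section \<open>Profiles with a concave logarithmic slope\<close>

text \<open>
  Isolates the one-sided derivative at \<open>r = 1\<close> from the computations below, in which all functions
  are differentiable on \<open>(0,\<infinity>)\<close>.
\<close>

lemma rderiv_eq:
  assumes "r \<in> {0<..1}" "\<And>s. s \<in> {0<..1} \<Longrightarrow> f s = g s" "(g has_real_derivative D) (at r)"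
  shows "(f has_vector_derivative D) (at r within {0<..1})" "rderiv f r = D"
proof -
  have "(g has_vector_derivative D) (at r within {0<..1})"
    using assms(3) by (simp add: has_real_derivative_iff_has_vector_derivative has_vector_derivative_at_within)
  then show *: "(f has_vector_derivative D) (at r within {0<..1})"
    by (rule has_vector_derivative_transform[OF assms(1), rotated]) (use assms(2) in auto)
  have "at r within {0<..1} \<noteq> bot"
  proof -
    have "r islimpt {r/2<..<r}" using assms(1) by (simp add: islimpt_greaterThanLessThan2)
    then have "r islimpt {0<..1}" by (rule islimpt_subset) (use assms(1) in auto)
    then show ?thesis by (simp add: trivial_limit_within)
  qed
  then show "rderiv f r = D"
    unfolding rderiv_def using * by (rule vector_derivative_within)
qed

text \<open>
  The functions \<open>v\<close>, \<open>w\<close> and \<open>d\<close> are \<open>r u'\<close> and its first two derivatives. They live on \<open>(0,\<infinity>)\<close>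
  rather than on \<open>(0,1]\<close>, so that \<open>u\<close> is onto the real line and determines \<open>g\<close> everywhere.
\<close>

locale concave_profile =
  fixes v w d :: "real \<Rightarrow> real"
  assumes v_deriv: "r > 0 \<Longrightarrow> (v has_real_derivative w r) (at r)"
    and w_deriv: "r > 0 \<Longrightarrow> (w has_real_derivative d r) (at r)"
    and d_continuous: "continuous_on {0<..} d"
    and v_ge_1: "r > 0 \<Longrightarrow> 1 \<le> v r"
    and v_le: "r > 0 \<Longrightarrow> v r \<le> 1 + 4 * r"
    and w_nonneg: "r > 0 \<Longrightarrow> 0 \<le> w r"
    and r_w_le: "r > 0 \<Longrightarrow> r * w r \<le> v r"
    and d_nonpos: "r > 0 \<Longrightarrow> d r \<le> 0"
begin

lemma v_pos: "r > 0 \<Longrightarrow> v r > 0"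
  using v_ge_1[of r] by linarith

lemma v_continuous: "continuous_on {0<..} v"
  by (rule DERIV_continuous_on[of _ v w]) (auto intro: has_field_derivative_at_within v_deriv)

lemma v_exp_continuous: "continuous_on UNIV (\<lambda>t. v (exp t))"
  by (rule continuous_on_compose2[OF v_continuous]) (auto intro!: continuous_intros)

text \<open>
  In the variable \<open>t = ln r\<close> the equation \<open>u' = v/r\<close> becomes \<open>P'(t) = v(exp t)\<close>. As \<open>v \<ge> 1\<close>, this
  \<open>P\<close> expands distances and is a bijection of the real line; \<open>Q\<close> below is its inverse.
\<close>

definition P :: "real \<Rightarrow> real" where
  "P = (SOME P. (\<forall>t. (P has_real_derivative v (exp t)) (at t)) \<and> P 0 = 0)"

lemma P_deriv: "(P has_real_derivative v (exp t)) (at t)" and P_0: "P 0 = 0"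
proof -
  have "\<exists>F. \<forall>x :: real. - \<infinity> < ereal x \<longrightarrow> ereal x < \<infinity> \<longrightarrow> (F has_vector_derivative v (exp x)) (at x)"
    by (rule einterval_antiderivative) (use v_exp_continuous in \<open>auto simp: continuous_on_eq_continuous_at\<close>)
  then obtain F where "\<And>x. (F has_real_derivative v (exp x)) (at x)"
    by (auto simp: has_real_derivative_iff_has_vector_derivative)
  then have "(\<forall>t. ((\<lambda>t. F t - F 0) has_real_derivative v (exp t)) (at t)) \<and> F 0 - F 0 = 0"
    by (auto intro!: derivative_eq_intros)
  then have "\<exists>P. (\<forall>t. (P has_real_derivative v (exp t)) (at t)) \<and> P 0 = 0"
    by (rule exI[of _ "\<lambda>t. F t - F 0"])
  from someI_ex[OF this] show "(P has_real_derivative v (exp t)) (at t)" "P 0 = 0"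
    unfolding P_def by auto
qed

lemma P_continuous: "continuous_on UNIV P"
  by (rule DERIV_continuous_on[of _ P "\<lambda>t. v (exp t)"]) (rule has_field_derivative_at_within[OF P_deriv])

lemma P_increment_ge: "s \<le> t \<Longrightarrow> t - s \<le> P t - P s"
proof -
  assume "s \<le> t"
  have "P s - s \<le> P t - t"
    by (rule DERIV_nonneg_imp_nondecreasing[OF \<open>s \<le> t\<close>])
      (use P_deriv v_ge_1 in \<open>auto intro!: derivative_eq_intros exI\<close>)
  then show ?thesis by simp
qed

lemma P_strict_mono: "strict_mono P"
proof (rule strict_monoI)
  fix s t :: real assume "s < t"
  then show "P s < P t" using P_increment_ge[of s t] by simp
qed

lemma P_bound:
  assumes "t \<le> 0"
  shows "\<bar>P t\<bar> \<le> 5 * \<bar>t\<bar>"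
proof -
  have "P 0 - 5 * 0 \<le> P t - 5 * t"
  proof (rule DERIV_nonpos_imp_nonincreasing[OF assms])
    fix s :: real assume "s \<le> 0"
    then have "exp s \<le> 1" by simp
    then have "v (exp s) \<le> 5" using v_le[of "exp s"] exp_gt_zero[of s] by linarith
    then show "\<exists>y. ((\<lambda>t. P t - 5 * t) has_real_derivative y) (at s) \<and> y \<le> 0"
      by (intro exI[of _ "v (exp s) - 5"]) (auto intro!: derivative_eq_intros P_deriv)
  qed
  then show ?thesis using P_increment_ge[OF assms] assms by (simp add: P_0)
qed

definition Q :: "real \<Rightarrow> real" where "Q = inv P"

lemma Q_P: "Q (P t) = t"
  unfolding Q_def using P_strict_mono by (simp add: strict_mono_imp_inj_on)

lemma P_Q: "P (Q y) = y"
proof -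
  have "\<exists>t. P t = y"
  proof -
    have "P (- \<bar>y\<bar>) \<le> y" "y \<le> P \<bar>y\<bar>"
      using P_increment_ge[of "- \<bar>y\<bar>" 0] P_increment_ge[of 0 "\<bar>y\<bar>"] by (simp_all add: P_0)
    then show ?thesis
      using IVT'[of P "- \<bar>y\<bar>" y "\<bar>y\<bar>"] P_continuous by (auto intro: continuous_on_subset)
  qed
  then show ?thesis unfolding Q_def by (metis f_inv_into_f rangeI)
qed

lemma Q_continuous: "continuous_on UNIV Q"
proof -
  have "\<bar>Q y - Q z\<bar> \<le> \<bar>y - z\<bar>" for y z
    using P_increment_ge[of "Q y" "Q z"] P_increment_ge[of "Q z" "Q y"]
    by (cases "Q y \<le> Q z") (auto simp: P_Q)
  then have "1-lipschitz_on UNIV Q"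
    by (intro lipschitz_onI) (auto simp: dist_real_def)
  then show ?thesis by (rule lipschitz_on_continuous_on)
qed

lemma Q_deriv: "(Q has_real_derivative inverse (v (exp (Q y)))) (at y)"
proof (rule DERIV_inverse_function[where f=P and a="y - 1" and b="y + 1"])
  show "isCont Q y" using Q_continuous by (simp add: continuous_on_eq_continuous_at)
  show "v (exp (Q y)) \<noteq> 0" using v_pos[of "exp (Q y)"] by simp
qed (auto simp: P_Q intro: P_deriv)

definition U :: "real \<Rightarrow> real" where "U r = P (ln r)"

lemma U_deriv: "r > 0 \<Longrightarrow> (U has_real_derivative v r / r) (at r)"
  unfolding U_def[abs_def] using DERIV_chain2[OF P_deriv[of "ln r"] DERIV_ln[of r]]
  by (simp add: divide_inverse)

lemma U_borel_measurable [measurable]: "U \<in> borel_measurable borel"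
  unfolding U_def[abs_def]
  by (rule measurable_compose[OF borel_measurable_ln borel_measurable_continuous_onI[OF P_continuous]]) simp

lemma U_strict_mono: "0 < r \<Longrightarrow> r < s \<Longrightarrow> U r < U s"
  unfolding U_def using P_strict_mono by (simp add: strict_mono_less)

lemma exp_Q_U: "r > 0 \<Longrightarrow> exp (Q (U r)) = r"
  by (simp add: U_def Q_P)

text \<open>
  \<open>\<alpha> = u'/r\<close> and \<open>\<gamma> = u''\<close> are the angular and the radial eigenvalue of the Hessian of \<open>u(|x|)\<close>,
  and \<open>U3\<close> is \<open>u'''\<close>.
\<close>

definition \<alpha> :: "real \<Rightarrow> real" where "\<alpha> r = v r / r\<^sup>2"
definition \<gamma> :: "real \<Rightarrow> real" where "\<gamma> r = w r / r - v r / r\<^sup>2"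
definition \<alpha>' :: "real \<Rightarrow> real" where "\<alpha>' r = w r / r\<^sup>2 - 2 * v r / r ^ 3"
definition U3 :: "real \<Rightarrow> real" where "U3 r = d r / r - 2 * w r / r\<^sup>2 + 2 * v r / r ^ 3"

lemma \<alpha>_pos: "r > 0 \<Longrightarrow> \<alpha> r > 0"
  using v_pos by (simp add: \<alpha>_def)

lemma \<alpha>_deriv: "r > 0 \<Longrightarrow> (\<alpha> has_real_derivative \<alpha>' r) (at r)"
  unfolding \<alpha>_def[abs_def] \<alpha>'_def
  by (auto intro!: derivative_eq_intros v_deriv simp: field_simps power2_eq_square power3_eq_cube)

lemma U_deriv2: "r > 0 \<Longrightarrow> ((\<lambda>r. v r / r) has_real_derivative \<gamma> r) (at r)"
  unfolding \<gamma>_def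
  by (auto intro!: derivative_eq_intros v_deriv simp: field_simps power2_eq_square)

lemma U_deriv3: "r > 0 \<Longrightarrow> (\<gamma> has_real_derivative U3 r) (at r)"
  unfolding \<gamma>_def[abs_def] U3_def
  by (auto intro!: derivative_eq_intros v_deriv w_deriv simp: field_simps power2_eq_square power3_eq_cube)

lemma rderiv_U: "r \<in> {0<..1} \<Longrightarrow> rderiv U r = v r / r"
  by (rule rderiv_eq(2)[OF _ _ U_deriv]) auto

lemma rderiv_rderiv_U: "r \<in> {0<..1} \<Longrightarrow> rderiv (rderiv U) r = \<gamma> r"
  by (rule rderiv_eq(2)[OF _ rderiv_U U_deriv2]) auto

lemma rderiv_rderiv_rderiv_U: "r \<in> {0<..1} \<Longrightarrow> rderiv (rderiv (rderiv U)) r = U3 r"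
  by (rule rderiv_eq(2)[OF _ rderiv_rderiv_U U_deriv3]) auto

lemma C2_profile_U: "C2_profile U"
proof -
  have "U differentiable (at r within {0<..1})" "rderiv U differentiable (at r within {0<..1})"
    if "r \<in> {0<..1}" for r
    using rderiv_eq(1)[OF that refl U_deriv] rderiv_eq(1)[OF that rderiv_U U_deriv2] that
    by (auto intro: differentiableI_vector)
  moreover have "continuous_on {0<..1} \<gamma>"
    by (rule DERIV_continuous_on[of _ \<gamma> U3]) (auto intro: has_field_derivative_at_within U_deriv3)
  then have "continuous_on {0<..1} (rderiv (rderiv U))"
    by (rule continuous_on_cong[OF refl rderiv_rderiv_U, THEN iffD2, rotated])
  ultimately show ?thesis by (auto simp: C2_profile_def differentiable_on_def)
qed

end

section \<open>Equation and semistability\<close>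

lemma times_binomial_pred:
  assumes "1 \<le> k" "k \<le> n"
  shows "k * (n - 1 choose k) = (n - k) * (n - 1 choose (k - 1))"
proof -
  obtain l where l: "k = Suc l" using assms by (cases k) auto
  have "k * (n - 1 choose k) = (n - 1) * (n - 1 - 1 choose l)"
    unfolding l by (rule binomial_absorption)
  also have "\<dots> = (n - 1 - l) * (n - 1 choose l)"
    by (rule binomial_absorb_comp[symmetric])
  finally show ?thesis by (simp add: l)
qed

text \<open>
  The left-hand side is the divergence of \<open>f \<psi>\<^sup>2 x\<close> for \<open>f = - R e / r\<^sup>2\<close>, with \<open>h\<close> and \<open>p\<close> in place
  of \<open>\<psi>\<close> and its radial derivative. The difference of the two sides is a square plus a multiple of
  \<open>h\<^sup>2\<close> from which \<open>q\<close> has disappeared: the coefficient \<open>q\<close> enters \<open>g'(u)\<close> and \<open>r f'\<close> alike. The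
  choice \<open>e = 4 - b\<close> comes from the logarithm \<open>u = ln r\<close>, where \<open>b = 0\<close>: with a constant \<open>e\<close>, the
  multiple of \<open>h\<^sup>2\<close> is \<open>(n - 2k)(e - 2) - e\<^sup>2\<close>, which at \<open>n - 2k = 8\<close> is \<open>-(e - 4)\<^sup>2\<close>.
\<close>

lemma riccati_inequality:
  fixes R b q e n k r p h :: real
  assumes "R \<ge> 0" "r > 0" "b \<ge> 0" "k \<ge> 0" "n - 2 * k \<ge> 8" "e = 4 - b"
  shows "h\<^sup>2 * (n * (- (R * e / r\<^sup>2)) - R / r\<^sup>2 * (((k - 1) * (b - 2) - 2) * e - (b + q - b\<^sup>2))) + 2 * (- (R * e / r\<^sup>2)) * h * (r * p)
     \<le> R * p\<^sup>2 + R / r\<^sup>2 * ((b - 2) * (n - 2 * k + k * b) + (b + q - b\<^sup>2)) * h\<^sup>2"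
proof -
  have "R * p\<^sup>2 + R / r\<^sup>2 * ((b - 2) * (n - 2 * k + k * b) + (b + q - b\<^sup>2)) * h\<^sup>2 -
     (h\<^sup>2 * (n * (- (R * e / r\<^sup>2)) - R / r\<^sup>2 * (((k - 1) * (b - 2) - 2) * e - (b + q - b\<^sup>2))) + 2 * (- (R * e / r\<^sup>2)) * h * (r * p))
     = R * (p + e / r * h)\<^sup>2 + R / r\<^sup>2 * h\<^sup>2 * (2 * (n - 2 * k) - 16 + b * (2 * k + 4))"
    using assms(2) unfolding assms(6) by (simp add: field_simps power2_eq_square) 
  also have "\<dots> \<ge> 0"
    using assms by (intro add_nonneg_nonneg mult_nonneg_nonneg) auto
  finally show ?thesis by simp
qed

context concave_profile
begin

text \<open>
  The scale-invariant first and second derivative of \<open>v\<close>. In terms of these, all powers of \<open>r\<close> and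
  \<open>v\<close> factor out of the equation and of its derivative.
\<close>

definition b :: "real \<Rightarrow> real" where "b r = r * w r / v r"
definition q :: "real \<Rightarrow> real" where "q r = r\<^sup>2 * d r / v r"

lemma b_bounds: "r > 0 \<Longrightarrow> 0 \<le> b r" "r > 0 \<Longrightarrow> b r \<le> 1"
  using w_nonneg[of r] r_w_le[of r] v_pos[of r] by (auto simp: b_def)

lemma q_nonpos: "r > 0 \<Longrightarrow> q r \<le> 0"
  using d_nonpos[of r] v_pos[of r] by (auto simp: q_def mult_nonneg_nonpos divide_nonpos_pos)

lemma b_deriv: "r > 0 \<Longrightarrow> (b has_real_derivative (b r + q r - (b r)\<^sup>2) / r) (at r)"
  unfolding b_def[abs_def] q_def using v_pos[of r]
  by (auto intro!: derivative_eq_intros v_deriv w_deriv simp: field_simps power2_eq_square)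

lemma \<gamma>_eq: "r > 0 \<Longrightarrow> \<gamma> r = \<alpha> r * (b r - 1)"
  using v_pos[of r] by (simp add: \<gamma>_def \<alpha>_def b_def field_simps power2_eq_square)

lemma \<alpha>'_eq: "r > 0 \<Longrightarrow> \<alpha>' r = \<alpha> r / r * (b r - 2)"
  using v_pos[of r] by (simp add: \<alpha>'_def \<alpha>_def b_def field_simps power2_eq_square power3_eq_cube)

lemma b_continuous: "continuous_on {0<..} b"
  by (rule DERIV_continuous_on[of _ b "\<lambda>r. (b r + q r - (b r)\<^sup>2) / r"]) (auto intro: has_field_derivative_at_within b_deriv)

lemma q_continuous: "continuous_on {0<..} q"
  unfolding q_def[abs_def] using v_pos
  by (intro continuous_intros d_continuous v_continuous) (auto simp: less_imp_neq[symmetric])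

lemma \<alpha>_continuous: "continuous_on {0<..} \<alpha>"
  by (rule DERIV_continuous_on[of _ \<alpha> \<alpha>']) (auto intro: has_field_derivative_at_within \<alpha>_deriv)

text \<open>
  The value of \<open>S\<^sub>k\<close> at the Hessian of \<open>u(|x|)\<close> in dimension \<open>n\<close>, its radial derivative, and the
  nonlinearity \<open>g\<close>, which expresses that value as a function of \<open>u\<close>.
\<close>

definition rhs :: "nat \<Rightarrow> nat \<Rightarrow> real \<Rightarrow> real" where
  "rhs n k r = (n - 1 choose k) * \<alpha> r ^ k + (n - 1 choose (k - 1)) * \<alpha> r ^ (k - 1) * \<gamma> r"

definition rhs' :: "nat \<Rightarrow> nat \<Rightarrow> real \<Rightarrow> real" where
  "rhs' n k r = (n - 1 choose (k - 1)) * \<alpha> r ^ k / r *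
     ((b r - 2) * (real n - 2 * k + k * b r) + (b r + q r - (b r)\<^sup>2))"

definition g :: "nat \<Rightarrow> nat \<Rightarrow> real \<Rightarrow> real" where "g n k y = rhs n k (exp (Q y))"

lemma rhs_eq:
  assumes "1 \<le> k" "k \<le> n" "r > 0"
  shows "rhs n k r = (n - 1 choose (k - 1)) / k * (\<alpha> r ^ k * (real n - 2 * k + k * b r))"
proof -
  have "real k * (n - 1 choose k) = (real n - k) * (n - 1 choose (k - 1))"
    using times_binomial_pred[OF assms(1,2)] assms(2) by (metis of_nat_diff of_nat_mult)
  then have "real (n - 1 choose k) = (n - 1 choose (k - 1)) / k * (real n - k)"
    using assms(1) by (simp add: field_simps)
  moreover have "\<alpha> r ^ (k - 1) * \<alpha> r = \<alpha> r ^ k"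
    using assms(1) by (cases k) auto
  ultimately have "rhs n k r = (n - 1 choose (k - 1)) / k * (real n - k) * \<alpha> r ^ k +
      (n - 1 choose (k - 1)) * (\<alpha> r ^ k * (b r - 1))"
    unfolding rhs_def \<gamma>_eq[OF assms(3)] by (simp add: mult_ac)
  then show ?thesis using assms(1) by (simp add: field_simps)
qed

lemma rhs_deriv:
  assumes k: "1 \<le> k" "k \<le> n" and r: "r > 0"
  shows "(rhs n k has_real_derivative rhs' n k r) (at r)"
proof -
  define c where "c = real (n - 1 choose (k - 1))"
  define N where "N = real n - 2 * k"
  have \<alpha>k: "((\<lambda>r. \<alpha> r ^ k) has_real_derivative k * (\<alpha> r ^ k / r * (b r - 2))) (at r)"
  proof (rule DERIV_cong[OF DERIV_power[OF \<alpha>_deriv[OF r]]])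
    have "\<alpha> r ^ k = \<alpha> r ^ (k - Suc 0) * \<alpha> r" using k by (cases k) auto
    then show "real k * (\<alpha>' r * \<alpha> r ^ (k - Suc 0)) = k * (\<alpha> r ^ k / r * (b r - 2))"
      by (simp add: \<alpha>'_eq[OF r])
  qed
  have "((\<lambda>r. c / k * (\<alpha> r ^ k * (N + k * b r))) has_real_derivative
     c / k * (k * (\<alpha> r ^ k / r * (b r - 2)) * (N + k * b r) + (k * ((b r + q r - (b r)\<^sup>2) / r)) * \<alpha> r ^ k)) (at r)"
    by (intro DERIV_cmult DERIV_mult[OF \<alpha>k] DERIV_add[of "\<lambda>_. N" 0, simplified] DERIV_const b_deriv r)
  moreover have "c / k * (k * (\<alpha> r ^ k / r * (b r - 2)) * (N + k * b r) + (k * ((b r + q r - (b r)\<^sup>2) / r)) * \<alpha> r ^ k) =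
      rhs' n k r"
    using k r by (simp add: rhs'_def c_def N_def field_simps)
  ultimately have 1: "((\<lambda>r. c / k * (\<alpha> r ^ k * (N + k * b r))) has_real_derivative rhs' n k r) (at r)" by simp
  have "\<forall>\<^sub>F r in nhds r. r \<in> {0<..}"
    using r by (intro eventually_nhds_in_open) auto
  then have "\<forall>\<^sub>F r in nhds r. rhs n k r = c / k * (\<alpha> r ^ k * (N + k * b r))"
    by eventually_elim (simp only: rhs_eq[OF k] c_def N_def greaterThan_iff of_nat_mult of_nat_numeral)
  from DERIV_cong_ev[OF refl this refl] 1 show ?thesis by blast
qed

lemma rhs_pos:
  assumes "1 \<le> k" "2 * k < n" "r > 0"
  shows "rhs n k r > 0"
proof -
  have "real n - 2 * k + k * b r > 0" "k - 1 \<le> n - 1"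
    using assms b_bounds(1)[of r] by (auto simp: add_pos_nonneg)
  then show ?thesis using assms by (simp add: rhs_eq \<alpha>_pos)
qed

text \<open>
  As \<open>b \<le> 1\<close>, the first summand is at most \<open>-(n - 2k) - k b \<le> -1 - b\<close>, which dominates the only
  positive term \<open>b\<close> of the second.
\<close>

lemma rhs'_nonpos:
  assumes "1 \<le> k" "2 * k < n" "r > 0"
  shows "rhs' n k r \<le> 0"
proof -
  define N where "N = real n - 2 * k"
  have N: "N \<ge> 1" using assms by (simp add: N_def)
  have bb: "0 \<le> b r" "b r \<le> 1" "q r \<le> 0" using b_bounds q_nonpos assms by auto
  have "(b r - 2) * (N + k * b r) \<le> - 1 * (N + k * b r)"
    using bb N by (intro mult_right_mono) auto
  also have "\<dots> \<le> - 1 - b r"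
    using N bb mult_right_mono[of 1 "real k" "b r"] assms by simp
  finally have 1: "(b r - 2) * (N + k * b r) + (b r + q r - (b r)\<^sup>2) \<le> 0"
    using bb zero_le_power2[of "b r"] by linarith
  have 2: "(n - 1 choose (k - 1)) * \<alpha> r ^ k / r \<ge> 0"
    using \<alpha>_pos[OF assms(3)] assms(3) by simp
  show ?thesis using mult_nonneg_nonpos[OF 2 1] by (simp add: rhs'_def N_def)
qed

lemma g_U: "r > 0 \<Longrightarrow> g n k (U r) = rhs n k r"
  by (simp add: g_def exp_Q_U)

lemma g_deriv:
  assumes "1 \<le> k" "k \<le> n"
  shows "(g n k has_real_derivative rhs' n k (exp (Q y)) * (exp (Q y) * inverse (v (exp (Q y))))) (at y)"
  unfolding g_def[abs_def]
  by (rule DERIV_chain2[OF rhs_deriv[OF assms]]) (auto intro!: DERIV_fun_exp Q_deriv)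

lemma deriv_g_U:
  assumes "1 \<le> k" "k \<le> n" "r > 0"
  shows "deriv (g n k) (U r) = (n - 1 choose (k - 1)) * \<alpha> r ^ (k - 1) / r\<^sup>2 *
     ((b r - 2) * (real n - 2 * k + k * b r) + (b r + q r - (b r)\<^sup>2))"
proof -
  have "deriv (g n k) (U r) = rhs' n k r * (r * inverse (v r))"
    using DERIV_imp_deriv[OF g_deriv[OF assms(1,2)]] by (simp add: exp_Q_U assms(3))
  moreover have "\<alpha> r ^ k = \<alpha> r ^ (k - 1) * (v r / r\<^sup>2)"
    using assms(1) unfolding \<alpha>_def by (cases k) auto
  then have "\<alpha> r ^ k / r * r * inverse (v r) = \<alpha> r ^ (k - 1) / r\<^sup>2"
    using v_pos[OF assms(3)] assms(3) by (simp add: field_simps)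
  then have "x * \<alpha> r ^ k / r * z * (r * inverse (v r)) = x * \<alpha> r ^ (k - 1) / r\<^sup>2 * z" for x z
    by (metis (no_types, opaque_lifting) mult.assoc mult.commute times_divide_eq_right)
  ultimately show ?thesis unfolding rhs'_def by simp
qed

lemma admissible_rhs_g:
  assumes "1 \<le> k" "2 * k < n"
  shows "admissible_rhs (g n k)"
proof -
  have k: "1 \<le> k" "k \<le> n" using assms by auto
  note dg = g_deriv[OF k]
  have cont: "continuous_on {0<..} (rhs' n k)"
    unfolding rhs'_def[abs_def]
    by (intro continuous_intros b_continuous q_continuous \<alpha>_continuous) auto
  have "deriv (g n k) = (\<lambda>y. rhs' n k (exp (Q y)) * (exp (Q y) * inverse (v (exp (Q y)))))"
    using DERIV_imp_deriv[OF dg] by auto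
  moreover have "continuous_on UNIV (\<lambda>y. rhs' n k (exp (Q y)) * (exp (Q y) * inverse (v (exp (Q y)))))"
    using v_pos
    by (intro continuous_on_mult continuous_on_inverse continuous_on_exp Q_continuous
        continuous_on_compose2[OF cont] continuous_on_compose2[OF v_continuous]) (auto simp: less_imp_neq[symmetric])
  moreover have "rhs' n k (exp (Q y)) * (exp (Q y) * inverse (v (exp (Q y)))) \<le> 0" for y
    using rhs'_nonpos[OF assms, of "exp (Q y)"] v_pos[of "exp (Q y)"] by (simp add: mult_nonpos_nonneg)
  moreover have "g n k differentiable_on UNIV"
    using dg by (auto simp: differentiable_on_def real_differentiable_def)
  moreover have "g n k y > 0" for y
    unfolding g_def by (rule rhs_pos[OF assms]) simp
  ultimately show ?thesis unfolding admissible_rhs_def by simp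
qed

lemma hessian_U:
  fixes x :: "real^'n"
  assumes "x \<noteq> 0"
  shows "hessian (\<lambda>x. U (norm x)) x = radial_matrix (\<alpha> (norm x)) (\<alpha>' (norm x) / norm x) x"
proof (rule hessian_radial[OF assms _ \<alpha>_deriv])
  show "(U has_real_derivative r * \<alpha> r) (at r)" if "r > 0" for r
    using U_deriv[OF that] that by (simp add: \<alpha>_def power2_eq_square)
qed (use assms in simp)

lemma \<gamma>_eq_hessian_entry: "r > 0 \<Longrightarrow> \<alpha> r + \<alpha>' r / r * r\<^sup>2 = \<gamma> r"
  by (simp add: \<gamma>_eq \<alpha>'_eq power2_eq_square field_simps)

lemma Sk_hessian_U:
  fixes x :: "real^'n"
  assumes "1 \<le> k" "k < CARD('n)" "x \<noteq> 0"
  shows "Sk k (hessian (\<lambda>x. U (norm x)) x) = g (CARD('n)) k (U (norm x))"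
  using assms \<gamma>_eq_hessian_entry[of "norm x"] by (simp add: hessian_U Sk_radial_matrix g_U rhs_def)

text \<open>
  The integrand dominates pointwise the divergence of a compactly supported field, which has
  integral \<open>0\<close>. An integrand that is not integrable has integral \<open>0\<close> by convention.
\<close>

lemma semistable_U:
  assumes k: "1 \<le> k" and n: "2 * k + 8 \<le> CARD('n::finite)"
  shows "semistable k (g (CARD('n)) k) (\<lambda>x::real^'n. U (norm x))"
  unfolding semistable_def
proof (intro allI impI)
  fix \<psi> :: "real^'n \<Rightarrow> real"
  assume \<psi>: "test_function (ball 0 1 - {0}) \<psi>"
  define u where "u = (\<lambda>x::real^'n. U (norm x))"
  define I where "I = (\<lambda>x. (\<Sum>i\<in>UNIV. \<Sum>j\<in>UNIV. partial_derivative i \<psi> x * partial_derivative j \<psi> x * Sk_deriv k i j (hessian u x))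
           + deriv (g (CARD('n)) k) (u x) * (\<psi> x)\<^sup>2)"
  define R where "R = (\<lambda>r. (CARD('n) - 1 choose (k - 1)) * \<alpha> r ^ (k - 1))"
  define e where "e = (\<lambda>r. 4 - b r)"
  define f where "f = (\<lambda>r. - (R r * e r / r\<^sup>2))"
  \<comment> \<open>The derivative of \<open>f\<close>, simplified by means of \<open>r \<alpha>' = \<alpha> (b - 2)\<close> and \<open>r b' = b + q - b\<^sup>2\<close>.\<close>
  define f' where "f' = (\<lambda>r. - (R r / r ^ 3 * (((real k - 1) * (b r - 2) - 2) * e r - (b r + q r - (b r)\<^sup>2))))"
  have R_nonneg: "R r \<ge> 0" if "r > 0" for r
    using \<alpha>_pos[OF that] by (simp add: R_def)
  have R_deriv: "(R has_real_derivative R r / r * ((real k - 1) * (b r - 2))) (at r)" if r: "r > 0" for r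
  proof -
    have "\<alpha> r ^ (k - 1 - Suc 0) * \<alpha> r = \<alpha> r ^ (k - 1)" if "k \<noteq> 1"
      using k that power_Suc2[of "\<alpha> r" "k - 1 - Suc 0"] by (simp add: Suc_diff_Suc)
    then have "real (k - 1) * (\<alpha>' r * \<alpha> r ^ (k - 1 - Suc 0)) = (real k - 1) * (\<alpha> r ^ (k - 1) / r * (b r - 2))"
      using k by (cases "k = 1") (auto simp: \<alpha>'_eq[OF r] of_nat_diff mult_ac)
    then have "((\<lambda>r. \<alpha> r ^ (k - 1)) has_real_derivative (real k - 1) * (\<alpha> r ^ (k - 1) / r * (b r - 2))) (at r)"
      by (rule DERIV_cong[OF DERIV_power[OF \<alpha>_deriv[OF r]]])
    from DERIV_cmult[OF this, of "real (CARD('n) - 1 choose (k - 1))"] show ?thesis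
      unfolding R_def by (rule DERIV_cong) simp
  qed
  have f_deriv: "(f has_real_derivative f' r) (at r)" if r: "r > 0" for r
    unfolding f_def f'_def e_def
    by (rule DERIV_cong, (rule DERIV_minus DERIV_divide DERIV_mult R_deriv DERIV_diff DERIV_const b_deriv DERIV_power DERIV_ident r)+)
      (use r in \<open>auto simp: field_simps power2_eq_square power3_eq_cube\<close>)
  have f'_cont: "continuous_on {0<..} f'"
    unfolding f'_def R_def e_def
    by (intro continuous_intros b_continuous q_continuous \<alpha>_continuous) auto
  define Div where "Div = (\<lambda>x. (\<psi> x)\<^sup>2 * (CARD('n) * f (norm x) + norm x * f' (norm x)) +
      2 * f (norm x) * \<psi> x * (\<Sum>i\<in>UNIV. x$i * partial_derivative i \<psi> x))"
  have Div: "integrable lborel Div" "integral\<^sup>L lborel Div = 0"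
    using integral_divergence_radial_field[OF \<psi> _ f_deriv f'_cont] by (simp_all add: Div_def)
  have Div_le: "Div x \<le> I x" for x
  proof (cases "x \<in> closure {x. \<psi> x \<noteq> 0}")
    case False
    then show ?thesis
      using test_function_outside_support(1)[of x \<psi>] test_function_outside_support(2)[of x \<psi>]
      by (simp add: Div_def I_def)
  next
    case True
    then have x: "x \<noteq> 0" using \<psi> by (auto simp: test_function_def)
    define r where "r = norm x"
    have r: "r > 0" using x by (simp add: r_def)
    define \<xi> where "\<xi> = (\<chi> i. partial_derivative i \<psi> x)"
    define p where "p = (x \<bullet> \<xi>) / r"
    have "(\<Sum>i\<in>UNIV. x$i * partial_derivative i \<psi> x) = r * p"
      using r by (simp add: p_def \<xi>_def inner_vec_def)
    then have "Div x = (\<psi> x)\<^sup>2 * (CARD('n) * (- (R r * e r / r\<^sup>2)) - R r / r\<^sup>2 * (((real k - 1) * (b r - 2) - 2) * e r - (b r + q r - (b r)\<^sup>2)))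
       + 2 * (- (R r * e r / r\<^sup>2)) * \<psi> x * (r * p)"
      using r unfolding Div_def r_def[symmetric] f_def f'_def by (simp add: power2_eq_square power3_eq_cube)
    also have "\<dots> \<le> R r * p\<^sup>2 + R r / r\<^sup>2 * ((b r - 2) * (real (CARD('n)) - 2 * real k + real k * b r) + (b r + q r - (b r)\<^sup>2)) * (\<psi> x)\<^sup>2"
      using n by (intro riccati_inequality R_nonneg r b_bounds) (auto simp: e_def)
    also have "R r / r\<^sup>2 * ((b r - 2) * (real (CARD('n)) - 2 * real k + real k * b r) + (b r + q r - (b r)\<^sup>2)) = deriv (g (CARD('n)) k) (u x)"
      using deriv_g_U[OF k _ r, of "CARD('n)"] n by (simp add: u_def R_def r_def)
    also have "R r * p\<^sup>2 \<le> (\<Sum>i\<in>UNIV. \<Sum>j\<in>UNIV. \<xi>$i * \<xi>$j * Sk_deriv k i j (hessian u x))"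
    proof -
      have "- \<alpha> r \<le> \<alpha> r + \<alpha>' r / r * r\<^sup>2"
        unfolding \<gamma>_eq_hessian_entry[OF r] \<gamma>_eq[OF r]
        using b_bounds(1)[OF r] \<alpha>_pos[OF r] by (simp add: right_diff_distrib)
      then show ?thesis
        using Sk_deriv_radial_matrix_ge[OF k _ \<alpha>_pos[OF r] _ x, of "\<alpha>' r / r" \<xi>] n x
        unfolding u_def by (simp add: hessian_U R_def p_def r_def)
    qed
    finally show ?thesis by (simp add: I_def \<xi>_def)
  qed
  have "(LINT x:ball 0 1|lebesgue. I x) \<ge> 0"
  proof (cases "set_integrable lebesgue (ball 0 1) I")
    case True
    have Div0: "Div x = 0" if "x \<notin> ball 0 1" for x
    proof -
      have "x \<notin> closure {x. \<psi> x \<noteq> 0}" using \<psi> that by (auto simp: test_function_def)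
      then show ?thesis using test_function_outside_support(1)[of x \<psi>] by (simp add: Div_def)
    qed
    have meas: "Div \<in> borel_measurable borel" using borel_measurable_integrable[OF Div(1)] by simp
    have "(\<lambda>x. indicator (ball 0 1) x *\<^sub>R Div x) = Div"
      using Div0 by (auto simp: indicator_def fun_eq_iff)
    then have "set_integrable lebesgue (ball 0 1) Div"
      using Div(1) meas by (simp add: set_integrable_def integrable_completion)
    then have "(LINT x:ball 0 1|lebesgue. Div x) \<le> (LINT x:ball 0 1|lebesgue. I x)"
      using True Div_le by (intro set_integral_mono) auto
    then show ?thesis
      using set_lebesgue_integral_eq_lborel[OF meas Div0, of "ball 0 1"] Div(2) by simp
  next
    case False
    then show ?thesis
      by (simp add: set_integrable_def set_lebesgue_integral_def not_integrable_integral_eq)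
  qed
  then show "0 \<le> (LINT x:ball 0 1|lebesgue.
           (\<Sum>i\<in>UNIV. \<Sum>j\<in>UNIV. partial_derivative i \<psi> x * partial_derivative j \<psi> x * Sk_deriv k i j (hessian (\<lambda>x. U (norm x)) x))
           + deriv (g (CARD('n)) k) (U (norm x)) * (\<psi> x)\<^sup>2)"
    unfolding I_def u_def .
qed

lemma semistable_radial_solution_U:
  assumes "1 \<le> k" "2 * k + 8 \<le> CARD('n::finite)"
  shows "semistable_radial_solution k (\<lambda>x::real^'n. U (norm x)) U"
  unfolding semistable_radial_solution_def
proof (intro conjI exI ballI)
  show "radial_with_profile (\<lambda>x::real^'n. U (norm x)) U"
    by (simp add: radial_with_profile_def)
  show "admissible_rhs (g (CARD('n)) k)" using assms by (intro admissible_rhs_g) auto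
  show "Sk k (hessian (\<lambda>x::real^'n. U (norm x)) x) = g (CARD('n)) k (U (norm x))" if "x \<in> ball 0 1 - {0}" for x
    using that assms by (intro Sk_hessian_U) auto
qed (use C2_profile_U semistable_U[OF assms] in auto)

end

section \<open>The weighted Sobolev space\<close>

lemma set_integrable_lebesgue_bound:
  fixes f :: "real^'n \<Rightarrow> 'b::{banach, second_countable_topology}"
  assumes "a < CARD('n)" "f \<in> borel_measurable borel"
    and "\<And>x. 0 < norm x \<Longrightarrow> norm x < 1 \<Longrightarrow> norm (f x) \<le> C * inverse (norm x ^ a)"
  shows "set_integrable lborel (ball 0 1) f" "set_integrable lebesgue (ball 0 1) f"
proof -
  have meas: "(\<lambda>x. indicator (ball 0 1) x *\<^sub>R f x) \<in> borel_measurable borel"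
    using assms(2) by (intro borel_measurable_scaleR borel_measurable_indicator) auto
  show *: "set_integrable lborel (ball 0 1) f"
    unfolding set_integrable_def
  proof (rule Bochner_Integration.integrable_bound)
    show "integrable lborel (\<lambda>x::real^'n. C * (indicator (ball 0 1) x *\<^sub>R inverse (norm x ^ a)))"
      using set_integrable_inverse_norm_power[OF assms(1)] unfolding set_integrable_def
      by (rule integrable_mult_right)
    show "AE x in lborel. norm (indicator (ball 0 1) x *\<^sub>R f x) \<le> norm (C * (indicator (ball 0 1) x *\<^sub>R inverse (norm x ^ a)))"
      using AE_lborel_singleton[of 0]
    proof eventually_elim
      case (elim x)
      then show ?case
        using assms(3)[of x] by (cases "norm x < 1") auto
    qed
  qed (use meas in simp)
  then show "set_integrable lebesgue (ball 0 1) f"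
    using meas by (simp add: set_integrable_def integrable_completion)
qed

lemma locally_integrable_ball:
  fixes f :: "real^'n \<Rightarrow> 'b::euclidean_space"
  assumes "set_integrable lebesgue (ball 0 1) f"
  shows "locally_integrable (ball 0 1) f"
  unfolding locally_integrable_def
proof (intro allI impI)
  fix K :: "(real^'n) set" assume "compact K \<and> K \<subseteq> ball 0 1"
  then show "f absolutely_integrable_on K"
    by (intro set_integrable_subset[OF assms]) (auto simp: lmeasurable_compact fmeasurableD)
qed

context concave_profile
begin

lemma U_abs_le: "0 < r \<Longrightarrow> r \<le> 1 \<Longrightarrow> \<bar>U r\<bar> \<le> 5 * - ln r"
  using P_bound[of "ln r"] by (simp add: U_def)

text \<open>
  \<open>|u|\<close> is at most a multiple of \<open>- ln r\<close>; with \<open>y = - ln r / (k+1)\<close>, the bound \<open>y \<le> exp y\<close> raised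
  to the power \<open>k + 1\<close> compares this with \<open>1/r\<close>.
\<close>

lemma U_power_le:
  assumes "0 < r" "r < 1"
  shows "\<bar>U r\<bar> ^ Suc k \<le> (5 * real (Suc k)) ^ Suc k * inverse r"
proof -
  define y where "y = - ln r / Suc k"
  have "y \<ge> 0"
    unfolding y_def by (rule divide_nonneg_nonneg) (use assms in auto)
  have "exp y ^ Suc k = inverse r"
    using assms unfolding y_def exp_of_nat_mult[symmetric] by (simp add: exp_minus)
  have "\<bar>U r\<bar> \<le> 5 * real (Suc k) * y" 
    using U_abs_le[of r] assms by (simp add: y_def del: of_nat_Suc)
  also have "\<dots> \<le> 5 * real (Suc k) * exp y"
  proof (rule mult_left_mono)
    show "y \<le> exp y" using exp_ge_add_one_self[of y] by linarith
  qed simp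
  finally have "\<bar>U r\<bar> ^ Suc k \<le> (5 * real (Suc k) * exp y) ^ Suc k"
    by (intro power_mono) auto
  also have "\<dots> = (5 * real (Suc k)) ^ Suc k * inverse r"
    unfolding power_mult_distrib \<open>exp y ^ Suc k = inverse r\<close> ..
  finally show ?thesis .
qed

lemma U_abs_le_inverse: "0 < r \<Longrightarrow> r < 1 \<Longrightarrow> \<bar>U r\<bar> \<le> 5 * inverse r"
  using U_power_le[of r 0] by simp

text \<open>
  The argument of \<open>v\<close> is written as \<open>exp (ln (norm x))\<close> to obtain a Borel function without knowing
  \<open>v\<close> on the negative axis. At the origin the value is \<open>0\<close>.
\<close>

definition grad :: "real^'n \<Rightarrow> real^'n" where
  "grad x = (v (exp (ln (norm x))) / (norm x)\<^sup>2) *\<^sub>R x"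

lemma grad_eq: "x \<noteq> 0 \<Longrightarrow> grad x = \<alpha> (norm x) *\<^sub>R x"
  by (simp add: grad_def \<alpha>_def)

lemma grad_borel_measurable [measurable]: "(grad :: real^'n \<Rightarrow> real^'n) \<in> borel_measurable borel"
proof -
  have "(\<lambda>t. v (exp t)) \<in> borel_measurable borel"
    by (rule borel_measurable_continuous_onI[OF v_exp_continuous])
  then have "(\<lambda>x::real^'n. v (exp (ln (norm x)))) \<in> borel_measurable borel"
    by (rule measurable_compose[rotated]) measurable
  then show ?thesis unfolding grad_def[abs_def] by measurable
qed

lemma norm_grad_le:
  assumes "0 < norm x" "norm x \<le> 2"
  shows "norm (grad x) \<le> 9 * inverse (norm x)"
proof -
  have x: "x \<noteq> 0" using assms by auto
  have "norm (grad x) = v (norm x) * inverse (norm x)"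
    using x v_pos[of "norm x"] by (simp add: grad_eq \<alpha>_def power2_eq_square field_simps)
  also have "\<dots> \<le> 9 * inverse (norm x)"
    using v_le[of "norm x"] assms by (intro mult_right_mono) auto
  finally show ?thesis .
qed

lemma U_norm_borel_measurable [measurable]: "(\<lambda>x::real^'n. U (norm x)) \<in> borel_measurable borel"
  by measurable

text \<open>
  The test functions do not vanish at the origin, where \<open>u\<close> is singular. The regularisations
  \<open>U (\<rho> m x)\<close>, with \<open>\<rho> m x\<close> the length of \<open>(x, 1/(m+1))\<close>, are continuously differentiable; since
  \<open>|x| \<le> \<rho> m x \<le> 2\<close> on the ball, both they and their gradients are dominated by a multiple of
  \<open>1 + 1/|x|\<close>.
\<close>

lemma weak_gradient_U:
  assumes "CARD('n) \<ge> 2"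
  shows "weak_gradient (ball 0 1) (\<lambda>x::real^'n. U (norm x)) grad"
  unfolding weak_gradient_def
proof (intro conjI allI impI)
  define u where "u = (\<lambda>x::real^'n. U (norm x))"
  have u_int: "set_integrable lborel (ball 0 1) u" "set_integrable lebesgue (ball 0 1) u"
    unfolding u_def
    by (rule set_integrable_lebesgue_bound[where a=1 and C=5]; use assms U_abs_le_inverse in simp)+
  have g_int: "set_integrable lborel (ball 0 1) (grad :: real^'n \<Rightarrow> real^'n)"
    "set_integrable lebesgue (ball 0 1) (grad :: real^'n \<Rightarrow> real^'n)"
  proof -
    have "norm (grad x) \<le> 9 * inverse (norm x ^ 1)" if "0 < norm x" "norm x < 1" for x :: "real^'n"
      using norm_grad_le[of x] that by simp
    moreover have "1 < CARD('n)" using assms by simp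
    ultimately show "set_integrable lborel (ball 0 1) (grad :: real^'n \<Rightarrow> real^'n)"
      "set_integrable lebesgue (ball 0 1) (grad :: real^'n \<Rightarrow> real^'n)"
      using set_integrable_lebesgue_bound[OF _ grad_borel_measurable] by blast+
  qed
  show "locally_integrable (ball 0 1) (\<lambda>x::real^'n. U (norm x))"
    using locally_integrable_ball[OF u_int(2)] by (simp add: u_def)
  show "locally_integrable (ball 0 1) (grad :: real^'n \<Rightarrow> real^'n)"
    by (rule locally_integrable_ball[OF g_int(2)])
  fix \<psi> :: "real^'n \<Rightarrow> real" and i
  assume \<psi>: "test_function (ball 0 1) \<psi>"
  obtain B where B: "B \<ge> 0" "\<And>x. \<bar>\<psi> x\<bar> \<le> B" "\<And>x. \<bar>partial_derivative i \<psi> x\<bar> \<le> B"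
    using test_function_bounded[OF \<psi>] by blast
  note \<psi>_cont = test_function_continuous[OF \<psi>]
  have \<psi>_meas: "\<psi> \<in> borel_measurable borel" "partial_derivative i \<psi> \<in> borel_measurable borel"
    using \<psi>_cont by (auto intro: borel_measurable_continuous_onI)
  have gi_meas: "(\<lambda>x::real^'n. grad x $ i) \<in> borel_measurable borel"
    by (rule measurable_compose[OF grad_borel_measurable borel_measurable_continuous_onI]) (intro continuous_intros)
  have out: "\<psi> x = 0" "partial_derivative i \<psi> x = 0" if "norm x \<ge> 1" for x
  proof -
    have "x \<notin> closure {x. \<psi> x \<noteq> 0}" using \<psi> that by (auto simp: test_function_def)
    then show "\<psi> x = 0" "partial_derivative i \<psi> x = 0"
      using test_function_outside_support(1)[of x \<psi>] test_function_outside_support(2)[of x \<psi>] by auto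
  qed
  define \<rho> where "\<rho> = (\<lambda>(m::nat) (x::real^'n). sqrt (x \<bullet> x + (inverse (Suc m))\<^sup>2))"
  have \<rho>_pos: "\<rho> m x > 0" for m x by (simp add: \<rho>_def add_nonneg_pos)
  have \<rho>_ge: "norm x \<le> \<rho> m x" for m x
    by (simp add: \<rho>_def norm_eq_sqrt_inner)
  have \<rho>_le: "\<rho> m x \<le> 2" if "norm x < 1" for m x
  proof -
    have "x \<bullet> x \<le> 1\<^sup>2" using that by (simp add: dot_square_norm power_le_one)
    moreover have "(inverse (real (Suc m)))\<^sup>2 \<le> 1\<^sup>2" by (intro power_mono) (auto simp: inverse_le_1_iff)
    ultimately have "x \<bullet> x + (inverse (Suc m))\<^sup>2 \<le> 2\<^sup>2" by simp
    then show ?thesis unfolding \<rho>_def by (intro real_le_lsqrt) auto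
  qed
  have \<rho>_cont: "continuous_on UNIV (\<rho> m)" for m
    unfolding \<rho>_def by (intro continuous_intros)
  have \<rho>_lim: "(\<lambda>m. \<rho> m x) \<longlonglongrightarrow> norm x" for x
  proof -
    have "(\<lambda>m. \<rho> m x) \<longlonglongrightarrow> sqrt (x \<bullet> x + 0\<^sup>2)"
      unfolding \<rho>_def by (intro tendsto_intros LIMSEQ_inverse_real_of_nat)
    then show ?thesis by (simp add: norm_eq_sqrt_inner)
  qed
  have \<rho>_deriv: "((\<lambda>t. \<rho> m (x + t *\<^sub>R axis i 1)) has_real_derivative x$i / \<rho> m x) (at 0)" for m x
  proof -
    have eq: "(x + t *\<^sub>R axis i 1) \<bullet> (x + t *\<^sub>R axis i 1) = x \<bullet> x + 2 * x$i * t + t\<^sup>2" for t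
      by (simp add: inner_add_left inner_add_right inner_axis inner_axis' power2_eq_square distrib_left)
    define h where "h = (\<lambda>t. x \<bullet> x + 2 * x$i * t + t\<^sup>2 + (inverse (Suc m))\<^sup>2)"
    have "(h has_real_derivative 2 * x$i) (at 0)"
      unfolding h_def by (auto intro!: derivative_eq_intros)
    moreover have h0: "h 0 > 0" "sqrt (h 0) = \<rho> m x"
      by (simp_all add: h_def \<rho>_def add_nonneg_pos)
    ultimately have "((\<lambda>t. sqrt (h t)) has_real_derivative inverse (sqrt (h 0)) / 2 * (2 * x$i)) (at 0)"
      using DERIV_chain2[where f=sqrt and g=h and x=0, OF DERIV_real_sqrt] by blast
    moreover have "(\<lambda>t. \<rho> m (x + t *\<^sub>R axis i 1)) = (\<lambda>t. sqrt (h t))"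
      unfolding \<rho>_def eq h_def ..
    moreover have "inverse (sqrt (h 0)) / 2 * (2 * x$i) = x$i / \<rho> m x"
    proof -
      have "inverse c / 2 * (2 * d) = d / c" for c d :: real by (simp add: field_simps)
      then show ?thesis unfolding h0(2) .
    qed
    ultimately show ?thesis by metis
  qed
  have contU: "continuous_on {0<..} U"
    by (rule DERIV_continuous_on[of _ U "\<lambda>r. v r / r"]) (auto intro: has_field_derivative_at_within U_deriv)
  define F where "F = (\<lambda>m x. U (\<rho> m x) * \<psi> x)"
  define D where "D = (\<lambda>m x. \<alpha> (\<rho> m x) * x$i * \<psi> x + U (\<rho> m x) * partial_derivative i \<psi> x)"
  define D0 where "D0 = (\<lambda>x. grad x $ i * \<psi> x + u x * partial_derivative i \<psi> x)"
  have contF: "continuous_on UNIV (F m)" for m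
    unfolding F_def by (intro continuous_on_mult continuous_on_compose2[OF contU \<rho>_cont] \<psi>_cont) (use \<rho>_pos in auto)
  have contD: "continuous_on UNIV (D m)" for m
    unfolding D_def
    by (intro continuous_intros continuous_on_compose2[OF contU \<rho>_cont] continuous_on_compose2[OF \<alpha>_continuous \<rho>_cont] \<psi>_cont)
      (use \<rho>_pos in auto)
  have der: "((\<lambda>t. F m (x + t *\<^sub>R axis i 1)) has_real_derivative D m x) (at 0)" for m x
  proof -
    have "(U has_real_derivative v (\<rho> m x) / \<rho> m x) (at (\<rho> m (x + 0 *\<^sub>R axis i 1)))"
      using U_deriv[OF \<rho>_pos, of m x] by simp
    from DERIV_mult[OF DERIV_chain2[OF this \<rho>_deriv] has_partial_derivative]
    show ?thesis
      unfolding F_def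
      by (rule DERIV_cong) (use \<psi> in \<open>auto simp: D_def \<alpha>_def test_function_def power2_eq_square\<close>)
  qed
  have int_D: "integral\<^sup>L lborel (D m) = 0" for m
    by (rule integral_partial_derivative_eq_0(2)[OF der contF contD, where R=1]) (use out in \<open>auto simp: F_def\<close>)
  have D_meas: "D m \<in> borel_measurable borel" for m
    by (rule borel_measurable_continuous_onI[OF contD])
  have "(\<lambda>m. integral\<^sup>L lborel (D m)) \<longlonglongrightarrow> integral\<^sup>L lborel D0"
  proof (rule integral_dominated_convergence)
    have "set_integrable lborel (ball 0 1) (\<lambda>x::real^'n. B * (14 * inverse (norm x ^ 1) + \<bar>U 2\<bar> * inverse (norm x ^ 0)))"
      by (intro set_integrable_mult_right set_integral_add set_integrable_inverse_norm_power) (use assms in auto)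
    then show "integrable lborel (\<lambda>x::real^'n. indicator (ball 0 1) x *\<^sub>R (B * (14 * inverse (norm x ^ 1) + \<bar>U 2\<bar> * inverse (norm x ^ 0))))"
      unfolding set_integrable_def .
    show "AE x in lborel. norm (D m x) \<le> indicator (ball 0 1) x *\<^sub>R (B * (14 * inverse (norm x ^ 1) + \<bar>U 2\<bar> * inverse (norm x ^ 0)))" for m
      using AE_lborel_singleton[of 0]
    proof eventually_elim
      case (elim x)
      show ?case
      proof (cases "norm x < 1")
        case True
        define s where "s = \<rho> m x"
        have x: "0 < norm x" "x \<noteq> 0" using elim by auto
        have s: "0 < s" "norm x \<le> s" "s \<le> 2" using \<rho>_pos \<rho>_ge \<rho>_le[OF True] by (auto simp: s_def)
        have "\<bar>\<alpha> s * x$i\<bar> \<le> \<alpha> s * s"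
          using \<alpha>_pos[OF s(1)] component_le_norm_cart[of x i] s by (simp add: abs_mult)
        also have "\<dots> = v s * inverse s" using s by (simp add: \<alpha>_def power2_eq_square divide_inverse)
        also have "\<dots> \<le> 9 * inverse (norm x)"
        proof (rule mult_mono)
          show "v s \<le> 9" using v_le[OF s(1)] s(3) by linarith
          show "inverse s \<le> inverse (norm x)" using s(2) x(1) by (rule le_imp_inverse_le)
          show "0 \<le> inverse s" using s(1) by simp
        qed simp
        finally have 1: "\<bar>\<alpha> s * x$i\<bar> \<le> 9 * inverse (norm x)" .
        have "U (norm x) \<le> U s" "U s \<le> U 2"
          using U_strict_mono[of "norm x" s] U_strict_mono[of s 2] s x by (auto simp: le_less)
        moreover have "\<bar>U (norm x)\<bar> \<le> 5 * inverse (norm x)"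
          using U_abs_le_inverse x True by simp
        ultimately have 2: "\<bar>U s\<bar> \<le> 5 * inverse (norm x) + \<bar>U 2\<bar>" by linarith
        have "\<bar>D m x\<bar> \<le> \<bar>\<alpha> s * x$i\<bar> * \<bar>\<psi> x\<bar> + \<bar>U s\<bar> * \<bar>partial_derivative i \<psi> x\<bar>"
          unfolding D_def s_def[symmetric] by (rule order_trans[OF abs_triangle_ineq]) (simp add: abs_mult)
        also have "\<dots> \<le> 9 * inverse (norm x) * B + (5 * inverse (norm x) + \<bar>U 2\<bar>) * B"
          using 1 2 B by (intro add_mono mult_mono) auto
        also have "\<dots> = B * (14 * inverse (norm x ^ 1) + \<bar>U 2\<bar> * inverse (norm x ^ 0))"
          by (simp add: algebra_simps)
        finally show ?thesis using True by simp
      next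
        case False
        then show ?thesis using out[of x] by (simp add: D_def)
      qed
    qed
    show "AE x in lborel. (\<lambda>m. D m x) \<longlonglongrightarrow> D0 x"
      using AE_lborel_singleton[of 0]
    proof eventually_elim
      case (elim x)
      then have x: "norm x \<in> {0<..}" by simp
      have "(\<lambda>m. U (\<rho> m x)) \<longlonglongrightarrow> U (norm x)" "(\<lambda>m. \<alpha> (\<rho> m x)) \<longlonglongrightarrow> \<alpha> (norm x)"
        using \<rho>_pos by (auto intro!: continuous_on_tendsto_compose[OF contU \<rho>_lim x] continuous_on_tendsto_compose[OF \<alpha>_continuous \<rho>_lim x])
      then have "(\<lambda>m. D m x) \<longlonglongrightarrow> \<alpha> (norm x) * x$i * \<psi> x + U (norm x) * partial_derivative i \<psi> x"
        unfolding D_def by (intro tendsto_intros)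
      then show ?case using elim by (simp add: D0_def u_def grad_eq)
    qed
    show "D0 \<in> borel_measurable lborel" 
      unfolding D0_def u_def
      by (intro borel_measurable_add borel_measurable_times) (use gi_meas \<psi>_meas U_norm_borel_measurable in simp_all)
  qed (use D_meas in simp)
  then have int_D0: "integral\<^sup>L lborel D0 = 0"
    by (simp add: int_D LIMSEQ_const_iff)
  have prod_int: "integrable lborel (\<lambda>x. h x * \<eta> x)"
    if "set_integrable lborel (ball 0 1) h" "\<And>x. \<bar>\<eta> x\<bar> \<le> B" "\<And>x. norm x \<ge> 1 \<Longrightarrow> \<eta> x = 0" "\<eta> \<in> borel_measurable borel"
      "h \<in> borel_measurable borel" for h \<eta> :: "real^'n \<Rightarrow> real"
  proof (rule Bochner_Integration.integrable_bound)
    show "integrable lborel (\<lambda>x. B * (indicator (ball 0 1) x *\<^sub>R h x))"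
      using that(1) unfolding set_integrable_def by (rule integrable_mult_right)
    show "AE x in lborel. norm (h x * \<eta> x) \<le> norm (B * (indicator (ball 0 1) x *\<^sub>R h x))"
    proof (rule AE_I2)
      fix x
      show "norm (h x * \<eta> x) \<le> norm (B * (indicator (ball 0 1) x *\<^sub>R h x))"
      proof (cases "norm x < 1")
        case True
        then show ?thesis
          using mult_right_mono[OF that(2)[of x], of "\<bar>h x\<bar>"] B(1) by (simp add: abs_mult mult.commute)
      qed (use that(3) in auto)
    qed
  qed (use that in simp)
  have gi: "set_integrable lborel (ball 0 1) (\<lambda>x. grad x $ i)"
  proof -
    have "integrable lborel (\<lambda>x. (indicator (ball 0 1) x *\<^sub>R grad x) $ i)"
      using g_int(1) unfolding set_integrable_def by (rule integrable_bounded_linear[OF bounded_linear_vec_nth])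
    then show ?thesis by (simp add: set_integrable_def)
  qed
  have i1: "integrable lborel (\<lambda>x. grad x $ i * \<psi> x)"
    by (rule prod_int[OF gi]) (use B out gi_meas \<psi>_meas in auto)
  have i2: "integrable lborel (\<lambda>x. u x * partial_derivative i \<psi> x)"
    by (rule prod_int[OF u_int(1)]) (use B out \<psi>_meas in \<open>auto simp: u_def\<close>)
  have "integral\<^sup>L lborel (\<lambda>x. grad x $ i * \<psi> x) + integral\<^sup>L lborel (\<lambda>x. u x * partial_derivative i \<psi> x) = 0"
    using int_D0 i1 i2 by (simp add: D0_def)
  moreover have "(LINT x:ball 0 1|lebesgue. U (norm x) * partial_derivative i \<psi> x) = integral\<^sup>L lborel (\<lambda>x. u x * partial_derivative i \<psi> x)"
    unfolding u_def
    by (rule set_lebesgue_integral_eq_lborel[OF borel_measurable_times]) (use out \<psi>_meas in auto)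
  moreover have "(LINT x:ball 0 1|lebesgue. grad x $ i * \<psi> x) = integral\<^sup>L lborel (\<lambda>x. grad x $ i * \<psi> x)"
    by (rule set_lebesgue_integral_eq_lborel[OF borel_measurable_times]) (use out gi_meas \<psi>_meas in auto)
  ultimately show "(LINT x:ball 0 1|lebesgue. U (norm x) * partial_derivative i \<psi> x) = - (LINT x:ball 0 1|lebesgue. grad x $ i * \<psi> x)"
    by simp
qed

lemma weighted_sobolev_U:
  assumes k: "1 \<le> k" "2 * k < CARD('n)"
  shows "weighted_sobolev k (\<lambda>x::real^'n. U (norm x))"
  unfolding weighted_sobolev_def
proof (intro conjI exI)
  have "(\<lambda>x::real^'n. U (norm x)) \<in> borel_measurable lebesgue"
    by (rule measurable_completion) (use U_norm_borel_measurable in simp)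
  then show "set_borel_measurable lebesgue (ball 0 1) (\<lambda>x::real^'n. U (norm x))"
    unfolding set_borel_measurable_def
    by (intro borel_measurable_scaleR borel_measurable_indicator) (simp_all add: fmeasurableD)
  show "set_integrable lebesgue (ball 0 1) (\<lambda>x::real^'n. \<bar>U (norm x)\<bar> ^ (k + 1))"
    by (rule set_integrable_lebesgue_bound(2)[where a=1 and C="(5 * real (Suc k)) ^ Suc k"])
      (use k U_power_le[of _ k] in auto)
  show "weak_gradient (ball 0 1) (\<lambda>x::real^'n. U (norm x)) grad"
    using k by (intro weak_gradient_U) auto
  show "set_integrable lebesgue (ball 0 1) (\<lambda>x::real^'n. norm x powr (1 - real k) * norm (grad x) ^ (k + 1))"
  proof (rule set_integrable_lebesgue_bound(2)[where a="2 * k" and C="9 ^ Suc k"])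
    fix x :: "real^'n" assume x: "0 < norm x" "norm x < 1"
    have "norm x powr (1 - real k) = norm x * inverse (norm x ^ k)"
      using x by (simp add: powr_diff powr_realpow divide_inverse)
    then have "norm x powr (1 - real k) * norm (grad x) ^ (k + 1) \<le> norm x * inverse (norm x ^ k) * (9 * inverse (norm x)) ^ (k + 1)"
      using norm_grad_le[of x] x by (intro mult_mono power_mono) auto
    also have "\<dots> = 9 ^ Suc k * inverse (norm x ^ (2 * k))"
    proof -
      have "norm x ^ (2 * k) = norm x ^ k * norm x ^ k" by (simp add: mult_2 power_add)
      then show ?thesis using x by (simp add: power_mult_distrib power_inverse[symmetric] field_simps)
    qed
    finally show "norm (norm x powr (1 - real k) * norm (grad x) ^ (k + 1)) \<le> 9 ^ Suc k * inverse (norm x ^ (2 * k))"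
      by simp
  qed (use k in simp, measurable)
qed

end

section \<open>Unbounded third derivatives\<close>

theorem corollary4p6:
  fixes k :: nat
  assumes "k \<ge> 1" and "CARD('n::finite) \<ge> 2 * k + 8"
  shows "\<not> (\<exists>\<phi> :: real \<Rightarrow> real. (\<forall>r\<in>{0<..1}. \<phi> r > 0) \<and>
    (\<forall>(u :: real^'n \<Rightarrow> real) U.
       weighted_sobolev k u \<and> semistable_radial_solution k u U \<and> strict_mono_on {0<..1} U \<longrightarrow>
       (\<exists>C>0. \<exists>\<epsilon>\<in>{0<..1}. \<forall>r\<in>{0<..\<epsilon>}. \<bar>rderiv (rderiv (rderiv U)) r\<bar> \<le> C * \<phi> r)))"
proof
  assume "\<exists>\<phi> :: real \<Rightarrow> real. (\<forall>r\<in>{0<..1}. \<phi> r > 0) \<and>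
    (\<forall>(u :: real^'n \<Rightarrow> real) U.
       weighted_sobolev k u \<and> semistable_radial_solution k u U \<and> strict_mono_on {0<..1} U \<longrightarrow>
       (\<exists>C>0. \<exists>\<epsilon>\<in>{0<..1}. \<forall>r\<in>{0<..\<epsilon>}. \<bar>rderiv (rderiv (rderiv U)) r\<bar> \<le> C * \<phi> r))"
  then obtain \<phi> :: "real \<Rightarrow> real" where *: "(\<forall>r\<in>{0<..1}. \<phi> r > 0) \<and>
    (\<forall>(u :: real^'n \<Rightarrow> real) U.
       weighted_sobolev k u \<and> semistable_radial_solution k u U \<and> strict_mono_on {0<..1} U \<longrightarrow>
       (\<exists>C>0. \<exists>\<epsilon>\<in>{0<..1}. \<forall>r\<in>{0<..\<epsilon>}. \<bar>rderiv (rderiv (rderiv U)) r\<bar> \<le> C * \<phi> r))"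
    by (elim exE)
  note \<phi> = conjunct1[OF *] and bound = conjunct2[OF *, rule_format, OF conjI, OF _ conjI]
  define s where "s = (\<lambda>m. 1 / real (Suc m))"
  have s: "0 < s m" "s m \<le> 1" for m by (auto simp: s_def)
  obtain v w d where vwd:
    "\<And>r. r > 0 \<Longrightarrow> (v has_real_derivative w r) (at r)"
    "\<And>r. r > 0 \<Longrightarrow> (w has_real_derivative d r) (at r)"
    "continuous_on {0<..} d"
    "\<And>r. r > 0 \<Longrightarrow> 1 \<le> v r" "\<And>r. r > 0 \<Longrightarrow> v r \<le> 1 + 4 * r"
    "\<And>r. r > 0 \<Longrightarrow> 0 \<le> w r" "\<And>r. r > 0 \<Longrightarrow> r * w r \<le> v r"
    "\<And>r. r > 0 \<Longrightarrow> d r \<le> 0"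
    \<comment> \<open>The summand \<open>10 / r\<^sup>2\<close> absorbs the term \<open>2 v / r\<^sup>3\<close> of \<open>u'''\<close>, as \<open>v \<le> 5\<close> on \<open>(0,1]\<close>.\<close>
    and large: "\<And>m. d (1 / real (Suc m)) \<le> - (s m * (real (Suc m) * \<phi> (s m)) + 10 / (s m)\<^sup>2)"
    by (rule exists_concave_function_with_large_second_derivative[of "\<lambda>m. s m * (real (Suc m) * \<phi> (s m)) + 10 / (s m)\<^sup>2"])
      (rule that; assumption)
  interpret concave_profile v w d
    by unfold_locales (fact vwd)+
  have "\<exists>C>0. \<exists>\<epsilon>\<in>{0<..1}. \<forall>r\<in>{0<..\<epsilon>}. \<bar>rderiv (rderiv (rderiv U)) r\<bar> \<le> C * \<phi> r"
  proof (rule bound)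
    show "weighted_sobolev k (\<lambda>x::real^'n. U (norm x))"
      using assms by (intro weighted_sobolev_U) auto
    show "semistable_radial_solution k (\<lambda>x::real^'n. U (norm x)) U"
      using assms by (intro semistable_radial_solution_U) auto
    show "strict_mono_on {0<..1} U"
      by (auto intro!: strict_mono_onI U_strict_mono)
  qed
  then obtain C \<epsilon> where C: "C > 0" "\<epsilon> \<in> {0<..1}"
    and le: "\<forall>r\<in>{0<..\<epsilon>}. \<bar>rderiv (rderiv (rderiv U)) r\<bar> \<le> C * \<phi> r"
    by (elim exE conjE bexE)
  obtain m :: nat where m: "max C (1 / \<epsilon>) < real m" using reals_Archimedean2 by blast
  define r where "r = s m"
  have r: "r > 0" "r \<le> 1" "\<phi> r > 0" using s[of m] \<phi> by (auto simp: r_def)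
  have "1 / \<epsilon> \<le> real (Suc m)" using m by simp
  then have "r \<le> \<epsilon>" using C(2) by (simp add: r_def s_def field_simps)
  have "U3 r \<le> - (real (Suc m) * \<phi> r)"
  proof -
    have "d r \<le> - (r * (real (Suc m) * \<phi> r) + 10 / r\<^sup>2)"
      using large[of m] by (simp add: r_def s_def)
    then have "d r / r \<le> - (r * (real (Suc m) * \<phi> r) + 10 / r\<^sup>2) / r"
      using r by (intro divide_right_mono) auto
    also have "\<dots> = - (real (Suc m) * \<phi> r) - 10 / r ^ 3"
      using r by (simp add: field_simps power2_eq_square power3_eq_cube)
    finally have 1: "d r / r \<le> - (real (Suc m) * \<phi> r) - 10 / r ^ 3" .
    have "2 * v r / r ^ 3 \<le> 10 / r ^ 3"
      using v_le[of r] r by (intro divide_right_mono) auto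
    moreover have "2 * w r / r\<^sup>2 \<ge> 0" using w_nonneg[of r] r by simp
    ultimately show ?thesis using 1 unfolding U3_def by linarith
  qed
  then have "real (Suc m) * \<phi> r \<le> \<bar>rderiv (rderiv (rderiv U)) r\<bar>"
    using r by (simp add: rderiv_rderiv_rderiv_U)
  also have "\<dots> \<le> C * \<phi> r"
    using \<open>r \<le> \<epsilon>\<close> r by (intro le[rule_format]) simp
  finally have "real (Suc m) \<le> C" using r by simp
  then show False using m by simp
qed

end
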